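(* Let $n\ge 2$, let $\mathbb{R}^n$ carry a fixed Euclidean metric, and let $\mathbb{R}^n$ be linearly embedded into $\mathbb{R}^{r+n}$. Let $\Phi:(\mathbb{R}^{r+n},0)\to(\mathbb{R}^n,0)$ be a germ of a smooth map whose restriction to $\mathbb{R}^n$ is the identity, and suppose that $\Phi$ takes vector lines to circles. Assume that the images of vector lines not contained in $\mathbb{R}^n$ do not degenerate to straight lines. Then there exist a Euclidean vector space $V$, a representation $\phi$ of the Clifford algebra $\mathrm{Cliff}(V)$ in $\mathbb{R}^n$ (compatible with the Euclidean metric of $\mathbb{R}^n$), and a linear embedding of $\mathbb{R}^{r+n}$ into $V\times\mathbb{R}^n$ that is the identity on $\mathbb{R}^n$ (i.e. sends $x\in\mathbb{R}^n$ to $(0,x)$), such that the map $$F:V\times\mathbb{R}^n\to\mathbb{R}^n,\qquad (\alpha,x)\mapsto\phi(1-\alpha)^{-1}x,$$ takes the germs at $0$ of all vector lines of $\mathbb{R}^{r+n}$ (regarded as lines in $V\times\mathbb{R}^n$ via the embedding) to the same circles as $\Phi$ does.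
   Context: A vector line is a $1$-dimensional vector subspace. By a "circle" in a Euclidean space we mean an honest Euclidean circle, or a straight line, or a single point. A map germ $\Phi$ at $0$ "takes vector lines to circles" if for every vector line $L$ the image under $\Phi$ of a sufficiently small neighborhood of $0$ in $L$ is contained in a circle (in this broad sense). The image of $L$ "degenerates to a straight line" if it is not a single point and is contained in a straight line; an image consisting of a single point is not regarded as degenerating to a line. Two maps $\Phi$ and $F$ take the germ of $L$ at $0$ to the same circle if the images of the germ of $L$ are either both the single point $0$, or both non-constant and contained in one and the same honest circle or straight line. For a Euclidean space $V$ with inner product $q(\cdot,\cdot)$, $\mathrm{Cliff}(V)$ denotes the associative unital real algebra generated by the vectors of $V$ subject to $vw+wv=-2q(v,w)\cdot 1$ for all $v,w\in V$ (so an orthonormal basis $e_1,\dots,e_k$ of $V$ satisfies $e_i^2=-1$, $e_ie_j+e_je_i=0$ for $i\neq j$). In the formula for $F$, $1-\alpha$ is an element of $V\oplus\langle 1\rangle\subset\mathrm{Cliff}(V)$; it is invertible for every $\alpha\in V$. A representation $\phi$ of $\mathrm{Cliff}(V)$ in the Euclidean space $\mathbb{R}^n$ is compatible with the Euclidean metric if every element of $V\oplus\langle 1\rangle$ acts conformally, i.e. multiplies all distances by a common factor. Representations of Clifford algebras in Euclidean spaces are always assumed compatible with the metric.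
   Formalization: "Takes vector lines to circles" is required with one neighborhood U of 0 serving all vector lines L (the image of L∩U lies in a circle); if the neighborhood may depend on L, the claim fails for some smooth germs. *)

theory Defs
  imports "HOL-Analysis.Finite_Function_Topology" "HOL-Analysis.Analysis" "HOL-Algebra.QuotRing"
begin

section \<open>Circles and germs at the origin\<close>

definition honest_circle :: "'a::euclidean_space set \<Rightarrow> bool" where
  "honest_circle C \<longleftrightarrow>
     (\<exists>P c \<rho>. affine P \<and> aff_dim P = 2 \<and> c \<in> P \<and> 0 < \<rho> \<and> C = sphere c \<rho> \<inter> P)"

definition straight_line :: "'a::euclidean_space set \<Rightarrow> bool" where
  "straight_line C \<longleftrightarrow> affine C \<and> aff_dim C = 1"

definition broad_circle :: "'a::euclidean_space set \<Rightarrow> bool" where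
  "broad_circle C \<longleftrightarrow> honest_circle C \<or> straight_line C \<or> (\<exists>p. C = {p})"

definition vector_line :: "'b::euclidean_space set \<Rightarrow> bool" where
  "vector_line L \<longleftrightarrow> subspace L \<and> dim L = 1"

text \<open>A map germ is represented by a total function; every notion below depends only on the
  values of the function near \<open>0\<close>.\<close>

definition germ_image_in :: "('b::euclidean_space \<Rightarrow> 'a) \<Rightarrow> 'b set \<Rightarrow> 'a set \<Rightarrow> bool" where
  "germ_image_in f L C \<longleftrightarrow> (\<forall>\<^sub>F x in nhds 0. x \<in> L \<longrightarrow> f x \<in> C)"

definition germ_constant :: "('b::euclidean_space \<Rightarrow> 'a) \<Rightarrow> 'b set \<Rightarrow> bool" where
  "germ_constant f L \<longleftrightarrow> (\<exists>p. germ_image_in f L {p})"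

text \<open>The smallness of the neighbourhood of \<open>0\<close> is a property of the germ \<open>f\<close>: one neighbourhood \<open>U\<close>
  serves all lines \<open>L\<close>, the neighbourhood of \<open>0\<close> in \<open>L\<close> being \<open>L \<inter> U\<close>.  For a merely smooth \<open>f\<close> this is
  essential.  If \<open>U\<close> could depend on \<open>L\<close>, a modification of \<open>f\<close> inside a cusp around a single line
  in the kernel of the differential, flat at \<open>0\<close>, would be invisible on every other line: take
  \<open>f (a, x) = x / (1 - i a) + \<chi> (x / a\<^sup>2) (exp (i h(a)) - 1)\<close> on \<open>\<real> \<times> \<complex>\<close> (second summand \<open>0\<close> for
  \<open>a = 0\<close>) with \<open>h(a) = exp (- 1 / a\<^sup>2)\<close> and \<open>\<chi>\<close> a bump function, \<open>\<chi> (0) = 1\<close>.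
  No map \<open>(\<alpha>, x) \<mapsto> \<phi>(1 - \<alpha>)\<^sup>-\<^sup>1 x\<close> agrees with it on all lines.\<close>

definition takes_vector_lines_to_circles ::
    "('b::euclidean_space \<Rightarrow> 'a::euclidean_space) \<Rightarrow> bool" where
  "takes_vector_lines_to_circles f \<longleftrightarrow>
     (\<exists>U. open U \<and> 0 \<in> U \<and>
       (\<forall>L. vector_line L \<longrightarrow> (\<exists>C. broad_circle C \<and> f ` (L \<inter> U) \<subseteq> C)))"

definition degenerates_to_line ::
    "('b::euclidean_space \<Rightarrow> 'a::euclidean_space) \<Rightarrow> 'b set \<Rightarrow> bool" where
  "degenerates_to_line f L \<longleftrightarrow>
     \<not> germ_constant f L \<and> (\<exists>C. straight_line C \<and> germ_image_in f L C)"

definition same_circle ::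
    "('b::euclidean_space \<Rightarrow> 'a::euclidean_space) \<Rightarrow> ('b \<Rightarrow> 'a) \<Rightarrow> 'b set \<Rightarrow> bool" where
  "same_circle f g L \<longleftrightarrow>
     germ_image_in f L {0} \<and> germ_image_in g L {0} \<or>
     \<not> germ_constant f L \<and> \<not> germ_constant g L \<and>
       (\<exists>C. (honest_circle C \<or> straight_line C) \<and> germ_image_in f L C \<and> germ_image_in g L C)"

text \<open>On an open set \<open>S\<close>, \<open>Ck_on k S f\<close> says that \<open>f\<close> is of class \<open>C\<^sup>k\<close>.\<close>

primrec Ck_on :: "nat \<Rightarrow> 'b::euclidean_space set \<Rightarrow> ('b \<Rightarrow> 'a::euclidean_space) \<Rightarrow> bool" where
  "Ck_on 0 S f \<longleftrightarrow> continuous_on S f"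
| "Ck_on (Suc k) S f \<longleftrightarrow> (\<forall>x\<in>S. f differentiable (at x)) \<and>
     (\<forall>v. Ck_on k S (\<lambda>x. frechet_derivative f (at x) v))"

definition smooth_germ :: "('b::euclidean_space \<Rightarrow> 'a::euclidean_space) \<Rightarrow> bool" where
  "smooth_germ f \<longleftrightarrow> (\<exists>U. open U \<and> 0 \<in> U \<and> (\<forall>k. Ck_on k U f))"


section \<open>Euclidean vector spaces as carrier sets\<close>

text \<open>Only the vector space structure of the type \<open>'v\<close> is used; the inner product is the
  explicit form \<open>q\<close>.  For \<open>'v = (nat \<Rightarrow>\<^sub>0 real)\<close>, which has countably infinite dimension,
  the pairs \<open>(V, q)\<close> include an isometric copy of every Euclidean vector space.  The norm that the
  library puts on this type plays no role.\<close>

definition euclidean_vector_space ::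
    "'v::real_vector set \<Rightarrow> ('v \<Rightarrow> 'v \<Rightarrow> real) \<Rightarrow> bool" where
  "euclidean_vector_space V q \<longleftrightarrow>
     subspace V \<and> (\<exists>B. finite B \<and> V = span B) \<and>
     (\<forall>u\<in>V. \<forall>v\<in>V. \<forall>w\<in>V. q (u + v) w = q u w + q v w) \<and>
     (\<forall>c. \<forall>v\<in>V. \<forall>w\<in>V. q (c *\<^sub>R v) w = c * q v w) \<and>
     (\<forall>v\<in>V. \<forall>w\<in>V. q v w = q w v) \<and>
     (\<forall>v\<in>V. v \<noteq> 0 \<longrightarrow> 0 < q v v)"


section \<open>Clifford algebras\<close>

text \<open>Words form the free monoid (written additively), so that the convolution product of
  \<open>Poly_Mapping\<close> turns finitely supported real functions on words into the free associative unital
  real algebra.\<close>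

datatype 'v free_word = Free_Word (letters: "'v list")

instantiation free_word :: (type) monoid_add
begin

definition zero_free_word :: "'a free_word" where
  "0 = Free_Word []"

definition plus_free_word :: "'a free_word \<Rightarrow> 'a free_word \<Rightarrow> 'a free_word" where
  "u + v = Free_Word (letters u @ letters v)"

instance
  by standard (simp_all add: zero_free_word_def plus_free_word_def)

end

type_synonym 'v free_alg = "'v free_word \<Rightarrow>\<^sub>0 real"

definition scal :: "real \<Rightarrow> 'v free_alg" where
  "scal c = Poly_Mapping.single 0 c"

definition gen :: "'v \<Rightarrow> 'v free_alg" where
  "gen v = Poly_Mapping.single (Free_Word [v]) 1"

definition free_algebra :: "'v set \<Rightarrow> 'v free_alg ring" where
  "free_algebra V =
     \<lparr>carrier = {p. \<forall>w\<in>Poly_Mapping.keys p. set (letters w) \<subseteq> V},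
      mult = (*), one = 1, zero = 0, add = (+)\<rparr>"

text \<open>The first two families of relators impose the linear structure of \<open>V\<close> on the formal
  generators, the third is the Clifford relation \<open>v w + w v = - 2 q(v, w)\<close>.\<close>

definition clifford_relators ::
    "'v::real_vector set \<Rightarrow> ('v \<Rightarrow> 'v \<Rightarrow> real) \<Rightarrow> 'v free_alg set" where
  "clifford_relators V q =
     {gen (v + w) - (gen v + gen w) | v w. v \<in> V \<and> w \<in> V} \<union>
     {gen (c *\<^sub>R v) - scal c * gen v | c v. v \<in> V} \<union>
     {gen v * gen w + gen w * gen v - scal (- 2 * q v w) | v w. v \<in> V \<and> w \<in> V}"

definition clifford_ideal ::
    "'v::real_vector set \<Rightarrow> ('v \<Rightarrow> 'v \<Rightarrow> real) \<Rightarrow> 'v free_alg set" where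
  "clifford_ideal V q = genideal (free_algebra V) (clifford_relators V q)"

definition Cliff ::
    "'v::real_vector set \<Rightarrow> ('v \<Rightarrow> 'v \<Rightarrow> real) \<Rightarrow> 'v free_alg set ring" where
  "Cliff V q = free_algebra V Quot clifford_ideal V q"

definition cliff_class ::
    "'v::real_vector set \<Rightarrow> ('v \<Rightarrow> 'v \<Rightarrow> real) \<Rightarrow> 'v free_alg \<Rightarrow> 'v free_alg set" where
  "cliff_class V q p = a_r_coset (free_algebra V) (clifford_ideal V q) p"

definition End_ring :: "('a::real_vector \<Rightarrow> 'a) ring" where
  "End_ring =
     \<lparr>carrier = {f. linear f}, mult = (\<circ>), one = id,
      zero = (\<lambda>_. 0), add = (\<lambda>f g x. f x + g x)\<rparr>"

text \<open>A representation is a homomorphism of unital real algebras into the endomorphisms.  For a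
  homomorphism of unital rings, real linearity amounts to the stated action of the scalars.\<close>

definition clifford_representation ::
    "'v::real_vector set \<Rightarrow> ('v \<Rightarrow> 'v \<Rightarrow> real) \<Rightarrow> ('v free_alg set \<Rightarrow> 'a::real_vector \<Rightarrow> 'a) \<Rightarrow> bool" where
  "clifford_representation V q \<phi> \<longleftrightarrow>
     \<phi> \<in> ring_hom (Cliff V q) End_ring \<and>
     (\<forall>c. \<phi> (cliff_class V q (scal c)) = (\<lambda>x. c *\<^sub>R x))"

definition metric_compatible ::
    "'v::real_vector set \<Rightarrow> ('v \<Rightarrow> 'v \<Rightarrow> real) \<Rightarrow> ('v free_alg set \<Rightarrow> 'a::euclidean_space \<Rightarrow> 'a) \<Rightarrow> bool" where
  "metric_compatible V q \<phi> \<longleftrightarrow>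
     (\<forall>v\<in>V. \<forall>t. \<exists>c. \<forall>x y.
        dist (\<phi> (cliff_class V q (gen v + scal t)) x) (\<phi> (cliff_class V q (gen v + scal t)) y)
          = c * dist x y)"

text \<open>The map \<open>(\<alpha>, x) \<mapsto> \<phi>(1 - \<alpha>)\<^sup>-\<^sup>1 x\<close>; it is meaningful for \<open>\<alpha> \<in> V\<close>.\<close>

definition clifford_map ::
    "'v::real_vector set \<Rightarrow> ('v \<Rightarrow> 'v \<Rightarrow> real) \<Rightarrow> ('v free_alg set \<Rightarrow> 'a::euclidean_space \<Rightarrow> 'a) \<Rightarrow>
      'v \<times> 'a \<Rightarrow> 'a" where
  "clifford_map V q \<phi> = (\<lambda>(\<alpha>, x). inv_into UNIV (\<phi> (cliff_class V q (1 - gen \<alpha>))) x)"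


subsection \<open>Well-definedness\<close>

text \<open>The quotient construction is only meaningful because \<open>free_algebra V\<close> is a ring containing
  the relators; otherwise \<^const>\<open>genideal\<close> would be an intersection over the empty family.  Moreover,
  \<^const>\<open>clifford_map\<close> involves a genuine inverse, see \<open>bij_clifford_operator\<close>.\<close>

lemma free_algebra_simps [simp]:
  "mult (free_algebra V) = (*)" "one (free_algebra V) = 1"
  "zero (free_algebra V) = 0" "add (free_algebra V) = (+)"
  by (simp_all add: free_algebra_def)

lemma free_algebra_carrier:
  "p \<in> carrier (free_algebra V) \<longleftrightarrow> (\<forall>w\<in>Poly_Mapping.keys p. set (letters w) \<subseteq> V)"
  by (simp add: free_algebra_def)

lemma scal_carrier: "scal c \<in> carrier (free_algebra V)"
  by (simp add: free_algebra_carrier scal_def zero_free_word_def)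

lemma gen_carrier: "v \<in> V \<Longrightarrow> gen v \<in> carrier (free_algebra V)"
  by (simp add: free_algebra_carrier gen_def)

lemma one_carrier: "1 \<in> carrier (free_algebra V)"
  using scal_carrier[of 1] by (simp add: scal_def)

lemma add_carrier:
  "a \<in> carrier (free_algebra V) \<Longrightarrow> b \<in> carrier (free_algebra V) \<Longrightarrow> a + b \<in> carrier (free_algebra V)"
  unfolding free_algebra_carrier using keys_add[of a b] by blast

lemma uminus_carrier:
  "a \<in> carrier (free_algebra V) \<Longrightarrow> - a \<in> carrier (free_algebra V)"
  by (simp add: free_algebra_carrier)

lemma diff_carrier:
  "a \<in> carrier (free_algebra V) \<Longrightarrow> b \<in> carrier (free_algebra V) \<Longrightarrow> a - b \<in> carrier (free_algebra V)"
  using add_carrier[of a V "- b"] uminus_carrier[of b V] by simp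

lemma mult_carrier:
  "a \<in> carrier (free_algebra V) \<Longrightarrow> b \<in> carrier (free_algebra V) \<Longrightarrow> a * b \<in> carrier (free_algebra V)"
  unfolding free_algebra_carrier
proof
  fix w assume a: "\<forall>w\<in>Poly_Mapping.keys a. set (letters w) \<subseteq> V"
    and b: "\<forall>w\<in>Poly_Mapping.keys b. set (letters w) \<subseteq> V" and "w \<in> Poly_Mapping.keys (a * b)"
  then obtain s t where "w = s + t" "s \<in> Poly_Mapping.keys a" "t \<in> Poly_Mapping.keys b"
    using keys_mult[of a b] by blast
  with a b show "set (letters w) \<subseteq> V"
    by (simp add: plus_free_word_def)
qed

lemma ring_free_algebra: "Ring.ring (free_algebra V)"
proof (rule ringI)
  show "abelian_group (free_algebra V)"
    by (rule abelian_groupI)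
      (auto simp: add_carrier algebra_simps free_algebra_carrier[of 0]
        intro: bexI[of _ "- _", OF _ uminus_carrier])
  show "Group.monoid (free_algebra V)"
    by (rule monoidI) (auto simp: mult_carrier one_carrier mult.assoc)
qed (auto simp: algebra_simps)

lemma clifford_relators_carrier:
  assumes "euclidean_vector_space V q"
  shows "clifford_relators V q \<subseteq> carrier (free_algebra V)"
proof -
  have "subspace V" using assms by (simp add: euclidean_vector_space_def)
  then show ?thesis
    by (auto simp: clifford_relators_def subspace_add subspace_scale
        intro!: diff_carrier add_carrier mult_carrier gen_carrier scal_carrier)
qed

lemma ideal_clifford_ideal:
  assumes "euclidean_vector_space V q"
  shows "ideal (clifford_ideal V q) (free_algebra V)"
  unfolding clifford_ideal_def
  by (rule ring.genideal_ideal[OF ring_free_algebra clifford_relators_carrier[OF assms]])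

lemma ring_Cliff:
  assumes "euclidean_vector_space V q"
  shows "Ring.ring (Cliff V q)"
  unfolding Cliff_def by (rule ideal.quotient_is_ring[OF ideal_clifford_ideal[OF assms]])

lemma free_algebra_minus:
  assumes "a \<in> carrier (free_algebra V)" "b \<in> carrier (free_algebra V)"
  shows "a \<ominus>\<^bsub>free_algebra V\<^esub> b = a - b"
proof -
  interpret R: Ring.ring "free_algebra V" by (rule ring_free_algebra)
  have "\<ominus>\<^bsub>free_algebra V\<^esub> b = - b"
    using assms(2) uminus_carrier[OF assms(2)] R.minus_equality[of "- b" b] by simp
  then show ?thesis by (simp add: a_minus_def)
qed

lemma cliff_class_mult:
  assumes "euclidean_vector_space V q"
    and "a \<in> carrier (free_algebra V)" "b \<in> carrier (free_algebra V)"
  shows "mult (Cliff V q) (cliff_class V q a) (cliff_class V q b) = cliff_class V q (a * b)"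
  using ideal.rcoset_mult_add[OF ideal_clifford_ideal[OF assms(1)] assms(2,3)]
  by (simp add: Cliff_def FactRing_def cliff_class_def)

lemma cliff_class_carrier:
  assumes "a \<in> carrier (free_algebra V)"
  shows "cliff_class V q a \<in> carrier (Cliff V q)"
  using assms by (auto simp: Cliff_def FactRing_def A_RCOSETS_def' cliff_class_def)

lemma cliff_class_eqI:
  assumes V: "euclidean_vector_space V q"
    and "a \<in> carrier (free_algebra V)" "b \<in> carrier (free_algebra V)" "a - b \<in> clifford_ideal V q"
  shows "cliff_class V q a = cliff_class V q b"
  using ring.quotient_eq_iff_same_a_r_cos[OF ring_free_algebra ideal_clifford_ideal[OF V] assms(2,3)] assms
  by (simp add: free_algebra_minus cliff_class_def)

lemma scal_simps: "scal a + scal b = scal (a + b)" "scal a * scal b = scal (a * b)" "scal 1 = 1"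
  "- scal a = scal (- a)" "scal a - scal b = scal (a - b)"
  by (simp_all add: scal_def single_add[symmetric] mult_single single_uminus single_diff)

lemma scal_one_plus: "scal (1 + c) = 1 + scal c"
  unfolding scal_simps(3)[symmetric] scal_simps(1) ..

lemma scal_uminus: "scal (- c) = - scal c"
  by (rule scal_simps(4)[symmetric])

lemma cliff_square:
  assumes V: "euclidean_vector_space V q" and v: "v \<in> V"
  shows "gen v * gen v - scal (- q v v) \<in> clifford_ideal V q"
proof -
  have "gen v * gen v + gen v * gen v - scal (- 2 * q v v) \<in> clifford_relators V q"
    unfolding clifford_relators_def using v by (intro UnI2 CollectI exI[of _ v]) simp
  then have "gen v * gen v + gen v * gen v - scal (- 2 * q v v) \<in> clifford_ideal V q"
    using ring.genideal_self[OF ring_free_algebra clifford_relators_carrier[OF V]]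
    unfolding clifford_ideal_def by (rule rev_subsetD)
  from ideal.I_l_closed[OF ideal_clifford_ideal[OF V] this scal_carrier[of "1/2"]]
  have "scal (1/2) * (gen v * gen v + gen v * gen v - scal (- 2 * q v v)) \<in> clifford_ideal V q"
    by simp
  moreover have "scal (1/2) * (gen v * gen v + gen v * gen v - scal (- 2 * q v v)) =
      (scal (1/2) + scal (1/2)) * (gen v * gen v) - scal (1/2) * scal (- 2 * q v v)"
    by (simp add: algebra_simps)
  ultimately show ?thesis
    by (simp add: scal_simps)
qed

lemma bij_clifford_operator:
  assumes V: "euclidean_vector_space V q" and \<phi>: "clifford_representation V q \<phi>" and v: "v \<in> V"
  shows "bij (\<phi> (cliff_class V q (1 - gen v)))"
proof -
  define A where "A = \<phi> (cliff_class V q (1 - gen v))"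
  define B where "B = \<phi> (cliff_class V q (1 + gen v))"
  let ?c = "1 + q v v"
  have carr: "1 - gen v \<in> carrier (free_algebra V)" "1 + gen v \<in> carrier (free_algebra V)"
    using v by (auto intro!: diff_carrier add_carrier one_carrier gen_carrier)
  have pos: "?c > 0"
  proof (cases "v = 0")
    case True
    have "\<forall>c. \<forall>v\<in>V. \<forall>w\<in>V. q (c *\<^sub>R v) w = c * q v w"
      using V unfolding euclidean_vector_space_def by (elim conjE)
    then have "q (0 *\<^sub>R v) v = 0 * q v v" using v by blast
    with True show ?thesis by simp
  next
    case False
    have "\<forall>v\<in>V. v \<noteq> 0 \<longrightarrow> 0 < q v v"
      using V unfolding euclidean_vector_space_def by (elim conjE)
    with False v have "0 < q v v" by blast
    then show ?thesis by simp
  qed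
  have comp: "\<phi> (cliff_class V q a) (\<phi> (cliff_class V q b) x) = ?c *\<^sub>R x"
    if ab: "a \<in> carrier (free_algebra V)" "b \<in> carrier (free_algebra V)"
      "a * b = 1 - gen v * gen v" for a b x
  proof -
    have "a * b - scal ?c = - (gen v * gen v - scal (- q v v))"
      by (simp add: ab(3) scal_one_plus scal_uminus)
    also have "\<dots> \<in> clifford_ideal V q"
      using ideal.I_l_closed[OF ideal_clifford_ideal[OF V] cliff_square[OF V v] scal_carrier[of "-1"]]
      by (simp add: scal_uminus scal_simps(3))
    finally have "cliff_class V q (a * b) = cliff_class V q (scal ?c)"
      by (intro cliff_class_eqI[OF V] mult_carrier ab scal_carrier)
    moreover have "\<phi> (cliff_class V q (a * b)) = \<phi> (cliff_class V q a) \<circ> \<phi> (cliff_class V q b)"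
      using ring_hom_mult[of \<phi> "Cliff V q" End_ring "cliff_class V q a" "cliff_class V q b"] \<phi>
      by (simp add: clifford_representation_def cliff_class_mult[OF V ab(1,2)]
          cliff_class_carrier ab End_ring_def)
    ultimately have E: "\<phi> (cliff_class V q a) \<circ> \<phi> (cliff_class V q b) = \<phi> (cliff_class V q (scal ?c))"
      by simp
    have "\<phi> (cliff_class V q (scal ?c)) = (\<lambda>x. ?c *\<^sub>R x)"
      using \<phi> by (simp only: clifford_representation_def)
    with fun_cong[OF E, of x] show ?thesis by simp
  qed
  have AB: "A (B x) = ?c *\<^sub>R x" for x
    unfolding A_def B_def by (rule comp) (auto simp: carr algebra_simps)
  have BA: "B (A x) = ?c *\<^sub>R x" for x
    unfolding A_def B_def by (rule comp) (auto simp: carr algebra_simps)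
  define c where "c = ?c"
  have c: "c \<noteq> 0" using pos by (simp add: c_def)
  have "inj A"
  proof (rule injI)
    fix x y assume "A x = A y"
    then have "B (A x) = B (A y)" by (rule arg_cong)
    then have "c *\<^sub>R x = c *\<^sub>R y" unfolding BA c_def[symmetric] .
    with c show "x = y" by simp
  qed
  moreover have "surj A"
  proof (rule surjI)
    fix y show "A (B ((1 / c) *\<^sub>R y)) = y"
      unfolding AB c_def[symmetric] using c by simp
  qed
  ultimately show ?thesis unfolding bij_def A_def by (rule conjI)
qed

end

theory Submission
  imports Defs "HOL-Computational_Algebra.Polynomial"
begin

text \<open>
  Write \<open>c (t) = \<Phi> (t y)\<close>, \<open>x = c' (0) = A y\<close> and \<open>v = c'' (0) / 2\<close>.  If \<open>x \<noteq> 0\<close>, the circle that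
  contains \<open>c\<close> passes through \<open>0\<close> with tangent \<open>x\<close>, and inversion at \<open>0\<close> turns it into a line of
  direction \<open>x\<close>.  In terms of the points \<open>p\<close> of the circle this says that \<open>|x|\<^sup>2 p - |p|\<^sup>2 v\<close> is a
  multiple of \<open>x\<close> (\<open>circle_second_order_relation\<close>), so the circle depends only on the 2-jet of \<open>\<Phi>\<close>.
  Along the line of \<open>(\<alpha>, x)\<close> a Clifford map has the 2-jet \<open>t x + t\<^sup>2 \<phi>(\<alpha>) x\<close>.  Hence it suffices to show that
  the second order part of \<open>\<Phi>\<close>, up to multiples of \<open>x\<close> itself, is \<open>S a x\<close> with \<open>y = a + \<iota> x\<close>,
  \<open>a\<close> in the kernel of \<open>A\<close>, and \<open>S a\<close> a linear family of operators that satisfy the Clifford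
  relation \<open>S a (S a x) = - q(a) x\<close> for a positive definite \<open>q\<close>.

  This comes from the Taylor coefficients of orders 3 and 4 (\<open>jet_relations\<close>).  They are
  polynomials in \<open>y\<close>, and the relation above expresses that certain products of lower order
  quantities are divisible by \<open>|x|\<^sup>2\<close>.  Restrict to \<open>x = e1 + s e2\<close> with \<open>e1\<close>, \<open>e2\<close> orthonormal, so
  that \<open>|x|\<^sup>2 = 1 + s\<^sup>2\<close>: divisibility means vanishing at \<open>s = i\<close>, that is, at an isotropic vector
  of the complexification, where a product can only vanish if a factor does.  Order 3 shows that
  the second derivative vanishes on the kernel of \<open>A\<close> and that its mixed part is
  \<open>x \<mapsto> dil a * x + S a x\<close> with \<open>S a\<close> skew (\<open>B_kernel\<close>, \<open>S_perp\<close>).  Order 4 shows that \<open>S a\<close>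
  multiplies all norms by the same factor (\<open>S_conformal\<close>).  A skew conformal operator has a
  negative scalar square, which is the Clifford relation; the square is not zero for \<open>a \<noteq> 0\<close> because
  otherwise the line of \<open>a + \<iota> x\<close> would be mapped into a straight line (\<open>qf_pos\<close>).

  On a line in the kernel of \<open>A\<close> the model is \<open>0\<close>, and \<open>\<Phi>\<close> must be shown to be \<open>0\<close>.
  The lines of \<open>a + \<iota> x\<close> with \<open>x \<rightarrow> 0\<close> approach the line of \<open>a\<close>, and their circles have diameter
  \<open>|x|\<^sup>2 / |S a x| = |x| / sqrt (q a)\<close>, which tends to \<open>0\<close> (\<open>\<Phi>_kernel\<close>).
\<close>

section \<open>Curves on circles through the origin\<close>

lemma subspace_if_affine_0:
  assumes "affine P" "0 \<in> P"
  shows "subspace P" and "aff_dim P = int (dim P)"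
  using assms by (auto simp: subspace_affine intro!: aff_dim_zero hull_inc)

text \<open>For a circle through \<open>0\<close> the plane is a linear subspace, and \<open>|p - m| = |m|\<close> becomes the quadratic
  equation below, which is easy to differentiate along a curve.\<close>

lemma honest_circle_through_0:
  fixes C :: "'a::euclidean_space set"
  assumes "honest_circle C" "0 \<in> C"
  obtains P m where "subspace P" "dim P = 2" "m \<in> P" "m \<noteq> 0" "C = {p \<in> P. p \<bullet> p = 2 * (m \<bullet> p)}"
proof -
  obtain P m \<rho> where P: "affine P" "aff_dim P = 2" "m \<in> P" "0 < \<rho>" and C: "C = sphere m \<rho> \<inter> P"
    using assms(1) unfolding honest_circle_def by blast
  have 0: "0 \<in> P" "\<rho> = norm m"
    using assms(2) by (auto simp: C)
  have *: "p \<in> sphere m \<rho> \<longleftrightarrow> p \<bullet> p = 2 * (m \<bullet> p)" for p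
    unfolding mem_sphere dist_norm 0(2) norm_eq inner_diff_left inner_diff_right
    by (simp add: inner_commute)
  have "C = {p \<in> P. p \<bullet> p = 2 * (m \<bullet> p)}"
    unfolding C using * by blast
  moreover have "m \<noteq> 0"
    using P(4) 0(2) by auto
  ultimately show thesis
    using that P subspace_if_affine_0[OF P(1) 0(1)] by auto
qed

lemma straight_line_through_0:
  assumes "straight_line C" "0 \<in> C"
  shows "subspace C" "dim C = 1"
  using assms subspace_if_affine_0[of C] by (auto simp: straight_line_def)

lemma straight_line_span:
  assumes "x \<noteq> 0"
  shows "straight_line (span {x})"
  using assms by (simp add: straight_line_def subspace_imp_affine aff_dim_subspace)

lemma has_derivative_of_vanishing:
  fixes g :: "real \<Rightarrow> real"
  assumes "open I" "t \<in> I" "\<And>t. t \<in> I \<Longrightarrow> g t = 0" "(g has_real_derivative d) (at t)"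
  shows "d = 0"
proof -
  have "(g has_real_derivative 0) (at t)"
    by (rule has_field_derivative_transform_within_open[OF DERIV_const[of 0] assms(1,2)])
      (simp add: assms(3))
  then show ?thesis
    using assms(4) DERIV_unique by blast
qed

lemma inner_has_real_derivative:
  assumes "(f has_vector_derivative f') (at t)" "(g has_vector_derivative g') (at t)"
  shows "((\<lambda>t. f t \<bullet> g t) has_real_derivative (f t \<bullet> g' + f' \<bullet> g t)) (at t)"
  using has_derivative_inner[OF assms[unfolded has_vector_derivative_def]]
  by (auto elim!: has_derivative_eq_rhs simp: has_field_derivative_def algebra_simps fun_eq_iff)

lemma inner_const_has_real_derivative:
  assumes "(f has_vector_derivative f') (at t)"
  shows "((\<lambda>t. f t \<bullet> \<xi>) has_real_derivative (f' \<bullet> \<xi>)) (at t)"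
  using inner_has_real_derivative[OF assms has_vector_derivative_const[of \<xi>]] by simp

text \<open>A derivative of a curve in \<open>P\<close> is orthogonal to everything that \<open>P\<close> is orthogonal to.
  With \<open>P = {0}\<close> the lemma also differentiates identities between curves.\<close>

lemma velocity_in_subspace:
  fixes c :: "real \<Rightarrow> 'a::euclidean_space"
  assumes "open I" "t \<in> I" and P: "subspace P" "\<And>t. t \<in> I \<Longrightarrow> c t \<in> P"
    and "(c has_vector_derivative c') (at t)"
  shows "c' \<in> P"
proof -
  obtain u w where u: "u \<in> span P" and w: "\<And>z. z \<in> span P \<Longrightarrow> orthogonal w z" and c': "c' = u + w"
    using orthogonal_subspace_decomp_exists by metis
  have vanish: "c t \<bullet> w = 0" if "t \<in> I" for t
    using w[OF span_base[OF P(2)[OF that]]] by (simp add: orthogonal_def inner_commute)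
  then have "c' \<bullet> w = 0"
    by (rule has_derivative_of_vanishing[where g = "\<lambda>t. c t \<bullet> w", OF assms(1,2)])
      (simp_all add: vanish inner_const_has_real_derivative[OF assms(5)])
  moreover have "u \<bullet> w = 0"
    using w[OF u] by (simp add: orthogonal_def inner_commute)
  ultimately have "w = 0"
    by (simp add: c' inner_add_left)
  with u show ?thesis
    by (simp add: c' span_eq_iff[THEN iffD2, OF P(1)])
qed

text \<open>The vectors of the plane \<open>P\<close> that are orthogonal to \<open>m\<close> are the multiples of \<open>x\<close>.\<close>

lemma two_dim_orthogonal:
  fixes P :: "'a::euclidean_space set"
  assumes P: "subspace P" "dim P = 2" "x \<in> P" "m \<in> P" "u \<in> P"
    and x: "x \<noteq> 0" "m \<noteq> 0" "m \<bullet> x = 0" and "m \<bullet> u = 0" "x \<bullet> \<xi> = 0"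
  shows "u \<bullet> \<xi> = 0"
proof -
  define w where "w = u - (u \<bullet> x / (x \<bullet> x)) *\<^sub>R x"
  have w: "w \<in> P"
    unfolding w_def by (intro subspace_diff subspace_scale P)
  have orth: "w \<bullet> x = 0" "w \<bullet> m = 0"
    using assms(6-9) unfolding w_def inner_diff_left inner_scaleR_left
    by (simp_all add: inner_commute[of _ m])
  have "w = 0"
  proof (rule ccontr)
    assume "w \<noteq> 0"
    have "pairwise orthogonal {w, x, m}"
      using orth x by (auto simp: pairwise_def orthogonal_def inner_commute)
    then have "independent {w, x, m}"
      using \<open>w \<noteq> 0\<close> x by (intro pairwise_orthogonal_independent) auto
    moreover have "card {w, x, m} = 3"
      using orth x \<open>w \<noteq> 0\<close> by (auto simp: card_insert_if)
    moreover have "{w, x, m} \<subseteq> P"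
      using w P by auto
    ultimately show False
      using independent_card_le_dim[of "{w, x, m}" P] P(2) by simp
  qed
  then have "u = (u \<bullet> x / (x \<bullet> x)) *\<^sub>R x"
    by (simp add: w_def)
  then show ?thesis
    using assms(10) by (metis inner_scaleR_left mult_zero_right)
qed

text \<open>The first two derivatives at \<open>0\<close> of the equation \<open>|c|\<^sup>2 = 2 m \<bullet> c\<close>.\<close>

lemma circle_jet:
  fixes c c1 c2 :: "real \<Rightarrow> 'a::euclidean_space"
  assumes I: "open I" "0 \<in> I"
    and c: "\<And>t. t \<in> I \<Longrightarrow> (c has_vector_derivative c1 t) (at t)"
      "\<And>t. t \<in> I \<Longrightarrow> (c1 has_vector_derivative c2 t) (at t)"
    and P: "subspace P" and C: "\<And>t. t \<in> I \<Longrightarrow> c t \<in> P \<and> c t \<bullet> c t = 2 * (m \<bullet> c t)"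
    and "c 0 = 0"
  shows "c1 0 \<in> P" "c2 0 \<in> P" "m \<bullet> c1 0 = 0" "m \<bullet> c2 0 = c1 0 \<bullet> c1 0"
proof -
  have c1: "c1 t \<in> P" if "t \<in> I" for t
    using velocity_in_subspace[OF I(1) that P] C c(1)[OF that] by blast
  then show "c1 0 \<in> P" "c2 0 \<in> P"
    using velocity_in_subspace[OF I P] c(2) I(2) by blast+
  have d1: "c t \<bullet> c1 t + c1 t \<bullet> c t - 2 * (m \<bullet> c1 t) = 0" if "t \<in> I" for t
  proof (rule has_derivative_of_vanishing[OF I(1) that])
    show "((\<lambda>t. c t \<bullet> c t - 2 * (c t \<bullet> m)) has_real_derivative
        (c t \<bullet> c1 t + c1 t \<bullet> c t - 2 * (m \<bullet> c1 t))) (at t)"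
      unfolding inner_commute[of m]
      by (intro DERIV_diff DERIV_cmult inner_has_real_derivative inner_const_has_real_derivative c that)
  qed (use C in \<open>auto simp: inner_commute\<close>)
  from d1[OF I(2)] \<open>c 0 = 0\<close> show "m \<bullet> c1 0 = 0" by simp
  have "(c 0 \<bullet> c2 0 + c1 0 \<bullet> c1 0) + (c1 0 \<bullet> c1 0 + c2 0 \<bullet> c 0) - 2 * (m \<bullet> c2 0) = 0"
  proof (rule has_derivative_of_vanishing[OF I])
    show "((\<lambda>t. c t \<bullet> c1 t + c1 t \<bullet> c t - 2 * (c1 t \<bullet> m)) has_real_derivative
        ((c 0 \<bullet> c2 0 + c1 0 \<bullet> c1 0) + (c1 0 \<bullet> c1 0 + c2 0 \<bullet> c 0) - 2 * (m \<bullet> c2 0))) (at 0)"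
      unfolding inner_commute[of m]
      by (intro DERIV_diff DERIV_add DERIV_cmult inner_has_real_derivative
          inner_const_has_real_derivative c I)
  qed (use d1 in \<open>auto simp: inner_commute\<close>)
  with \<open>c 0 = 0\<close> show "m \<bullet> c2 0 = c1 0 \<bullet> c1 0" by simp
qed

lemma dim_1_subspace_eq_span:
  fixes x :: "'a::euclidean_space"
  assumes "subspace C" "dim C = 1" "x \<in> C" "x \<noteq> 0"
  shows "C = span {x}"
  using assms by (intro subspace_dim_equal[symmetric]) (auto simp: span_minimal)

text \<open>The vector \<open>u = 2 |x|\<^sup>2 p - |p|\<^sup>2 c'' (0)\<close>, where \<open>x = c' (0)\<close>, lies in the plane of the circle, and it is
  orthogonal to the centre \<open>m\<close> by \<open>circle_jet\<close>; hence it is a multiple of \<open>x\<close>.  Testing with vectors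
  \<open>\<xi>\<close> orthogonal to \<open>x\<close> expresses this without mentioning the circle, and in the same form for a
  straight line, where both sides are \<open>0\<close>.\<close>

lemma circle_second_order_relation:
  fixes c c1 c2 :: "real \<Rightarrow> 'a::euclidean_space"
  assumes I: "open I" "0 \<in> I"
    and c: "\<And>t. t \<in> I \<Longrightarrow> (c has_vector_derivative c1 t) (at t)"
      "\<And>t. t \<in> I \<Longrightarrow> (c1 has_vector_derivative c2 t) (at t)"
    and C: "broad_circle C" "\<And>t. t \<in> I \<Longrightarrow> c t \<in> C" and c0: "c 0 = 0" and x: "c1 0 \<noteq> 0"
    and "p \<in> C" and \<xi>: "c1 0 \<bullet> \<xi> = 0"
  shows "2 * (c1 0 \<bullet> c1 0) * (p \<bullet> \<xi>) = (p \<bullet> p) * (c2 0 \<bullet> \<xi>)"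
proof -
  have "0 \<in> C" using C(2)[OF I(2)] c0 by simp
  from C(1) consider "honest_circle C" | "straight_line C" | q where "C = {q}"
    unfolding broad_circle_def by blast
  then show ?thesis
  proof cases
    case 1
    then obtain P m where P: "subspace P" "dim P = 2" "m \<in> P" "m \<noteq> 0"
      and C_eq: "C = {p \<in> P. p \<bullet> p = 2 * (m \<bullet> p)}"
      using \<open>0 \<in> C\<close> by (rule honest_circle_through_0)
    note jet = circle_jet[OF I c P(1) _ c0, of m]
    have j: "c1 0 \<in> P" "c2 0 \<in> P" "m \<bullet> c1 0 = 0" "m \<bullet> c2 0 = c1 0 \<bullet> c1 0"
      using jet C(2) C_eq by auto
    have p: "p \<in> P" "p \<bullet> p = 2 * (m \<bullet> p)"
      using \<open>p \<in> C\<close> C_eq by auto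
    define u where "u = (2 * (c1 0 \<bullet> c1 0)) *\<^sub>R p - (p \<bullet> p) *\<^sub>R c2 0"
    have "u \<in> P"
      unfolding u_def by (intro subspace_diff subspace_scale P p j)
    moreover have "m \<bullet> u = 0"
      by (simp add: u_def inner_diff_right j p(2))
    ultimately have "u \<bullet> \<xi> = 0"
      using two_dim_orthogonal[OF P(1,2) j(1) P(3)] x P(4) j(3) \<xi> by blast
    then show ?thesis
      by (simp add: u_def inner_diff_left)
  next
    case 2
    note L = straight_line_through_0[OF 2 \<open>0 \<in> C\<close>]
    have c1: "c1 t \<in> C" if "t \<in> I" for t
      using velocity_in_subspace[OF I(1) that L(1)] C(2) c(1)[OF that] by blast
    then have j: "c1 0 \<in> C" "c2 0 \<in> C"
      using velocity_in_subspace[OF I L(1)] c(2) I(2) by blast+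
    have "C = span {c1 0}"
      using dim_1_subspace_eq_span[OF L j(1) x] .
    then have "p \<bullet> \<xi> = 0" "c2 0 \<bullet> \<xi> = 0"
      using j(2) \<open>p \<in> C\<close> \<xi> by (auto simp: span_singleton)
    then show ?thesis by simp
  next
    case 3
    then have "c t \<in> {0}" if "t \<in> I" for t
      using C(2)[OF that] \<open>0 \<in> C\<close> by simp
    then have "c1 0 \<in> {0}"
      using velocity_in_subspace[OF I subspace_single_0 _ c(1)[OF I(2)]] by blast
    with x show ?thesis by simp
  qed
qed

text \<open>Third and fourth derivatives at \<open>0\<close> of the relation \<open>a (c \<bullet> \<xi>) = |c|\<^sup>2 b\<close> for a curve with
  \<open>c (0) = 0\<close>.\<close>

lemma higher_order_relations:
  fixes c c1 c2 c3 c4 :: "real \<Rightarrow> 'a::euclidean_space"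
  assumes I: "open I" "0 \<in> I"
    and c: "\<And>t. t \<in> I \<Longrightarrow> (c has_vector_derivative c1 t) (at t)"
      "\<And>t. t \<in> I \<Longrightarrow> (c1 has_vector_derivative c2 t) (at t)"
      "\<And>t. t \<in> I \<Longrightarrow> (c2 has_vector_derivative c3 t) (at t)"
      "\<And>t. t \<in> I \<Longrightarrow> (c3 has_vector_derivative c4 t) (at t)"
    and c0: "c 0 = 0"
    and rel: "\<And>t. t \<in> I \<Longrightarrow> a * (c t \<bullet> \<xi>) = (c t \<bullet> c t) * b"
  shows "a * (c3 0 \<bullet> \<xi>) = 6 * (c1 0 \<bullet> c2 0) * b"
    and "a * (c4 0 \<bullet> \<xi>) = (6 * (c2 0 \<bullet> c2 0) + 8 * (c1 0 \<bullet> c3 0)) * b"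
proof -
  note di = inner_has_real_derivative inner_const_has_real_derivative DERIV_diff DERIV_add
    DERIV_cmult DERIV_cmult_right c
  have r1: "a * (c1 t \<bullet> \<xi>) - (2 * (c t \<bullet> c1 t)) * b = 0" if t: "t \<in> I" for t
  proof (rule has_derivative_of_vanishing[OF I(1) t])
    have "((\<lambda>t. a * (c t \<bullet> \<xi>) - (c t \<bullet> c t) * b) has_real_derivative
        a * (c1 t \<bullet> \<xi>) - (c t \<bullet> c1 t + c1 t \<bullet> c t) * b) (at t)"
      by (intro di t)
    then show "((\<lambda>t. a * (c t \<bullet> \<xi>) - (c t \<bullet> c t) * b) has_real_derivative
        a * (c1 t \<bullet> \<xi>) - (2 * (c t \<bullet> c1 t)) * b) (at t)"
      by (simp add: inner_commute)
  qed (simp add: rel)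
  have r2: "a * (c2 t \<bullet> \<xi>) - (2 * (c1 t \<bullet> c1 t + c t \<bullet> c2 t)) * b = 0" if t: "t \<in> I" for t
  proof (rule has_derivative_of_vanishing[OF I(1) t])
    have "((\<lambda>t. a * (c1 t \<bullet> \<xi>) - (2 * (c t \<bullet> c1 t)) * b) has_real_derivative
        a * (c2 t \<bullet> \<xi>) - (2 * (c t \<bullet> c2 t + c1 t \<bullet> c1 t)) * b) (at t)"
      by (intro di t)
    then show "((\<lambda>t. a * (c1 t \<bullet> \<xi>) - (2 * (c t \<bullet> c1 t)) * b) has_real_derivative
        a * (c2 t \<bullet> \<xi>) - (2 * (c1 t \<bullet> c1 t + c t \<bullet> c2 t)) * b) (at t)"
      by (simp add: add.commute)
  qed (rule r1)
  have r3: "a * (c3 t \<bullet> \<xi>) - (2 * (3 * (c1 t \<bullet> c2 t) + c t \<bullet> c3 t)) * b = 0" if t: "t \<in> I" for t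
  proof (rule has_derivative_of_vanishing[OF I(1) t])
    have "((\<lambda>t. a * (c2 t \<bullet> \<xi>) - (2 * (c1 t \<bullet> c1 t + c t \<bullet> c2 t)) * b) has_real_derivative
        a * (c3 t \<bullet> \<xi>) - (2 * ((c1 t \<bullet> c2 t + c2 t \<bullet> c1 t) + (c t \<bullet> c3 t + c1 t \<bullet> c2 t))) * b) (at t)"
      by (intro di t)
    then show "((\<lambda>t. a * (c2 t \<bullet> \<xi>) - (2 * (c1 t \<bullet> c1 t + c t \<bullet> c2 t)) * b) has_real_derivative
        a * (c3 t \<bullet> \<xi>) - (2 * (3 * (c1 t \<bullet> c2 t) + c t \<bullet> c3 t)) * b) (at t)"
      by (simp add: inner_commute algebra_simps)
  qed (rule r2)
  have r4: "a * (c4 0 \<bullet> \<xi>) - (2 * (3 * (c1 0 \<bullet> c3 0 + c2 0 \<bullet> c2 0) + (c 0 \<bullet> c4 0 + c1 0 \<bullet> c3 0))) * b = 0"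
  proof (rule has_derivative_of_vanishing[OF I])
    show "((\<lambda>t. a * (c3 t \<bullet> \<xi>) - (2 * (3 * (c1 t \<bullet> c2 t) + c t \<bullet> c3 t)) * b) has_real_derivative
        a * (c4 0 \<bullet> \<xi>) - (2 * (3 * (c1 0 \<bullet> c3 0 + c2 0 \<bullet> c2 0) + (c 0 \<bullet> c4 0 + c1 0 \<bullet> c3 0))) * b) (at 0)"
      by (intro di I)
  qed (rule r3)
  show "a * (c3 0 \<bullet> \<xi>) = 6 * (c1 0 \<bullet> c2 0) * b"
    using r3[OF I(2)] by (simp add: c0)
  show "a * (c4 0 \<bullet> \<xi>) = (6 * (c2 0 \<bullet> c2 0) + 8 * (c1 0 \<bullet> c3 0)) * b"
    using r4 by (simp add: c0 algebra_simps)
qed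


section \<open>Divisibility by \<open>1 + s\<^sup>2\<close> and conformal forms\<close>

text \<open>The conclusions are the real and the imaginary part of the statement that the cubic on the
  left vanishes at \<open>s = i\<close>.  The proof subtracts \<open>(1 + s\<^sup>2) (r2 + r3 s)\<close>, which leaves a
  polynomial of degree at most one.\<close>

lemma coefficients_if_one_plus_square_dvd:
  fixes p :: "real poly"
  assumes "\<And>s. r0 + r1 * s + r2 * s^2 + r3 * s^3 = (1 + s^2) * poly p s"
  shows "r0 = r2" and "r1 = r3"
proof -
  define p' where "p' = p - [:r2, r3:]"
  have "poly [:r0 - r2, r1 - r3:] s = poly ([:1, 0, 1:] * p') s" for s
    using assms[of s] by (simp add: p'_def algebra_simps power2_eq_square power3_eq_cube)
  then have eq: "[:r0 - r2, r1 - r3:] = [:1, 0, 1:] * p'"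
    by (simp add: poly_eq_poly_eq_iff[symmetric] fun_eq_iff)
  have "p' = 0"
  proof (rule ccontr)
    assume "p' \<noteq> 0"
    then have "degree ([:1, 0, 1:] * p') = 2 + degree p'"
      by (subst degree_mult_eq) auto
    then show False
      unfolding eq[symmetric] by (simp split: if_splits)
  qed
  with eq have "[:r0 - r2, r1 - r3:] = 0" by simp
  then show "r0 = r2" "r1 = r3"
    by (simp_all split: if_splits)
qed

text \<open>The values on an orthonormal pair \<open>u\<close>, \<open>w\<close> being equal, the pair \<open>(u + w) / sqrt 2\<close>,
  \<open>(u - w) / sqrt 2\<close> shows that also the cross term \<open>\<beta> u w + \<beta> w u\<close> vanishes.  Any \<open>x\<close> is a
  combination of \<open>e\<close> and one unit vector orthogonal to \<open>e\<close>.\<close>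

lemma conformal_form:
  fixes \<beta> :: "'a::euclidean_space \<Rightarrow> 'a \<Rightarrow> real"
  assumes \<beta>: "bilinear \<beta>"
    and eq: "\<And>u w. norm u = 1 \<Longrightarrow> norm w = 1 \<Longrightarrow> u \<bullet> w = 0 \<Longrightarrow> \<beta> u u = \<beta> w w"
    and e: "norm e = 1"
  shows "\<beta> x x = \<beta> e e * (x \<bullet> x)"
proof -
  note bil = bilinear_ladd[OF \<beta>] bilinear_radd[OF \<beta>] bilinear_lsub[OF \<beta>] bilinear_rsub[OF \<beta>]
    bilinear_lmul[OF \<beta>] bilinear_rmul[OF \<beta>]
  have cross: "\<beta> u w + \<beta> w u = 0" if uw: "norm u = 1" "norm w = 1" "u \<bullet> w = 0" for u w
  proof -
    have sq: "u \<bullet> u = 1" "w \<bullet> w = 1" "w \<bullet> u = 0"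
      using uw by (auto simp: norm_eq_1 inner_commute)
    define k where "k = 1 / sqrt 2"
    have k: "k * k = 1/2" "k \<noteq> 0" by (auto simp: k_def)
    have "\<beta> (k *\<^sub>R (u + w)) (k *\<^sub>R (u + w)) = \<beta> (k *\<^sub>R (u - w)) (k *\<^sub>R (u - w))"
    proof (rule eq)
      show "norm (k *\<^sub>R (u + w)) = 1" "norm (k *\<^sub>R (u - w)) = 1" "k *\<^sub>R (u + w) \<bullet> k *\<^sub>R (u - w) = 0"
        using k unfolding norm_eq_1 by (auto simp: inner_add inner_diff sq uw(3) algebra_simps)
    qed
    then have "k * k * (2 * (\<beta> u w + \<beta> w u)) = 0"
      by (simp add: bil algebra_simps)
    then show ?thesis
      using k(1) by simp
  qed
  define w where "w = x - (x \<bullet> e) *\<^sub>R e"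
  have ee: "e \<bullet> e = 1" using e by (simp add: norm_eq_1)
  have we: "w \<bullet> e = 0"
    by (simp add: w_def inner_diff_left ee)
  have x: "x = (x \<bullet> e) *\<^sub>R e + w"
    by (simp add: w_def)
  show ?thesis
  proof (cases "w = 0")
    case True
    then obtain \<alpha> where "x = \<alpha> *\<^sub>R e" using x by auto
    then show ?thesis by (simp add: bil ee)
  next
    case False
    define u where "u = (1 / norm w) *\<^sub>R w"
    have u: "norm u = 1" "u \<bullet> e = 0" "e \<bullet> u = 0" and w: "w = norm w *\<^sub>R u"
      using False we by (auto simp: u_def inner_commute)
    obtain \<alpha> \<nu> where x: "x = \<alpha> *\<^sub>R e + \<nu> *\<^sub>R u"
      using x w by metis
    have "\<beta> x x = \<alpha> * \<alpha> * \<beta> e e + \<alpha> * \<nu> * (\<beta> e u + \<beta> u e) + \<nu> * \<nu> * \<beta> u u"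
      by (simp add: x bil algebra_simps)
    also have "\<dots> = \<beta> e e * (\<alpha> * \<alpha> + \<nu> * \<nu>)"
      using cross[OF e u(1,3)] eq[OF e u(1,3)] by (simp add: algebra_simps)
    also have "\<alpha> * \<alpha> + \<nu> * \<nu> = x \<bullet> x"
      using u(1)[unfolded norm_eq_1] by (simp add: x inner_add ee u(2,3))
    finally show ?thesis .
  qed
qed

section \<open>Iterated directional derivatives\<close>

definition smooth_on :: "'b::euclidean_space set \<Rightarrow> ('b \<Rightarrow> 'a::euclidean_space) \<Rightarrow> bool" where
  "smooth_on U f \<longleftrightarrow> (\<forall>k. Ck_on k U f)"

definition dirder :: "'b::euclidean_space \<Rightarrow> ('b \<Rightarrow> 'a::euclidean_space) \<Rightarrow> 'b \<Rightarrow> 'a" where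
  "dirder v f x = frechet_derivative f (at x) v"

lemma Ck_on_subset: "Ck_on k U f \<Longrightarrow> W \<subseteq> U \<Longrightarrow> Ck_on k W f"
  by (induction k arbitrary: f) (auto intro: continuous_on_subset)

lemma smooth_on_dirder: "smooth_on U f \<Longrightarrow> smooth_on U (dirder v f)"
  unfolding smooth_on_def dirder_def[abs_def] by (metis Ck_on.simps(2))

lemma smooth_on_dirder_funpow: "smooth_on U f \<Longrightarrow> smooth_on U ((dirder v ^^ k) f)"
  by (induction k) (simp_all add: smooth_on_dirder)

lemma smooth_on_continuous_on: "smooth_on U f \<Longrightarrow> continuous_on U f"
  unfolding smooth_on_def by (metis Ck_on.simps(1))

lemma smooth_on_has_derivative:
  assumes "smooth_on U f" "x \<in> U"
  shows "(f has_derivative (\<lambda>v. dirder v f x)) (at x)"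
proof -
  have "f differentiable at x"
    using assms unfolding smooth_on_def by (metis Ck_on.simps(2))
  then show ?thesis
    unfolding dirder_def by (simp add: frechet_derivative_works)
qed

lemma linear_dirder:
  assumes "smooth_on U f" "x \<in> U"
  shows "linear (\<lambda>v. dirder v f x)"
  using smooth_on_has_derivative[OF assms] by (rule has_derivative_linear)

lemma dirder_eqI:
  assumes "open U" "x \<in> U" "\<And>z. z \<in> U \<Longrightarrow> f z = g z" "(g has_derivative g') (at x)"
  shows "dirder v f x = g' v"
proof -
  have "(f has_derivative g') (at x)"
    using assms(4,1,2) by (rule has_derivative_transform_within_open) (simp add: assms(3))
  then show ?thesis
    unfolding dirder_def by (metis frechet_derivative_at)
qed

lemma has_vector_derivative_along_line:
  assumes "smooth_on U f" "t *\<^sub>R y \<in> U"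
  shows "((\<lambda>t. f (t *\<^sub>R y)) has_vector_derivative dirder y f (t *\<^sub>R y)) (at t)"
proof -
  have "((\<lambda>t. t *\<^sub>R y) has_derivative (\<lambda>s. s *\<^sub>R y)) (at t)"
    by (auto intro!: derivative_eq_intros)
  from has_derivative_compose[OF this smooth_on_has_derivative[OF assms]]
  show ?thesis
    unfolding has_vector_derivative_def linear_scale[OF linear_dirder[OF assms]] .
qed

text \<open>In the neighbourhood \<open>U\<close> of \<open>x\<close> the function \<open>dirder w f\<close> depends linearly on \<open>w\<close>, and the derivative at
  \<open>x\<close> sees only the values there.\<close>

lemma dirder_second_linear:
  assumes "open U" "smooth_on U f" "x \<in> U"
  shows "linear (\<lambda>w. dirder v (dirder w f) x)"
proof (rule linearI)
  fix w w' and c :: real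
  have d: "(dirder w f has_derivative (\<lambda>v. dirder v (dirder w f) x)) (at x)" for w
    by (rule smooth_on_has_derivative[OF smooth_on_dirder[OF assms(2)] assms(3)])
  show "dirder v (dirder (w + w') f) x = dirder v (dirder w f) x + dirder v (dirder w' f) x"
    by (rule dirder_eqI[OF assms(1,3) _ has_derivative_add[OF d d]])
      (simp add: linear_add[OF linear_dirder[OF assms(2)]])
  show "dirder v (dirder (c *\<^sub>R w) f) x = c *\<^sub>R dirder v (dirder w f) x"
    by (rule dirder_eqI[OF assms(1,3) _ has_derivative_scaleR_right[OF d]])
      (simp add: linear_scale[OF linear_dirder[OF assms(2)]])
qed

lemma bilinear_second_derivative:
  assumes "open U" "smooth_on U f" "x \<in> U"
  shows "bilinear (\<lambda>v w. dirder v (dirder w f) x)"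
  unfolding bilinear_def
  using dirder_second_linear[OF assms] linear_dirder[OF smooth_on_dirder[OF assms(2)] assms(3)]
  by blast

text \<open>The \<open>k\<close>-th derivative in direction \<open>y0 + s y1\<close> is a polynomial in \<open>s\<close>.  Writing it as a sum of
  monomials times smooth functions, with exponents that may repeat, lets the induction
  differentiate term by term: each step replaces \<open>s\<^sup>e g\<close> by the two terms \<open>s\<^sup>e \<partial>\<^sub>0 g\<close> and
  \<open>s\<^sup>e s \<partial>\<^sub>1 g\<close>, which is why the number of terms doubles.\<close>

lemma dirder_funpow_expansion:
  assumes U: "open U" and f: "smooth_on U f"
  obtains N :: nat and e :: "nat \<Rightarrow> nat" and g where "\<And>i. smooth_on U (g i)"
    and "\<And>s x. x \<in> U \<Longrightarrow> (dirder (y0 + s *\<^sub>R y1) ^^ k) f x = (\<Sum>i<N. s ^ e i *\<^sub>R g i x)"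
proof -
  have "\<exists>(N::nat) e g. (\<forall>i. smooth_on U (g i)) \<and>
    (\<forall>s. \<forall>x\<in>U. (dirder (y0 + s *\<^sub>R y1) ^^ k) f x = (\<Sum>i<N. s ^ e i *\<^sub>R g i x))"
  proof (induction k)
    case 0
    show ?case
      by (intro exI[of _ "1::nat"] exI[of _ "\<lambda>_. 0"] exI[of _ "\<lambda>_. f"]) (simp add: f)
  next
    case (Suc k)
    then obtain N :: nat and e g where g: "\<And>i. smooth_on U (g i)"
      and eq: "\<And>s x. x \<in> U \<Longrightarrow> (dirder (y0 + s *\<^sub>R y1) ^^ k) f x = (\<Sum>i<N. s ^ e i *\<^sub>R g i x)"
      by blast
    define e' where "e' i = (if i < N then e i else Suc (e (i - N)))" for i
    define g' where "g' i = (if i < N then dirder y0 (g i) else dirder y1 (g (i - N)))" for i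
    have "(dirder (y0 + s *\<^sub>R y1) ^^ Suc k) f x = (\<Sum>i<N + N. s ^ e' i *\<^sub>R g' i x)" if x: "x \<in> U" for s x
    proof -
      have "((\<lambda>x. \<Sum>i<N. s ^ e i *\<^sub>R g i x) has_derivative
          (\<lambda>v. \<Sum>i<N. s ^ e i *\<^sub>R dirder v (g i) x)) (at x)"
        by (intro has_derivative_sum has_derivative_scaleR_right smooth_on_has_derivative[OF g x])
      then have "(dirder (y0 + s *\<^sub>R y1) ^^ Suc k) f x
          = (\<Sum>i<N. s ^ e i *\<^sub>R dirder (y0 + s *\<^sub>R y1) (g i) x)"
        using dirder_eqI[OF U x eq] by simp
      also have "\<dots> = (\<Sum>i<N. s ^ e i *\<^sub>R dirder y0 (g i) x) + (\<Sum>i<N. s ^ Suc (e i) *\<^sub>R dirder y1 (g i) x)"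
        unfolding sum.distrib[symmetric]
        by (rule sum.cong) (simp_all add: linear_add[OF linear_dirder[OF g x]]
            linear_scale[OF linear_dirder[OF g x]] scaleR_add_right mult.commute)
      also have "(\<Sum>i<N. s ^ e i *\<^sub>R dirder y0 (g i) x) = (\<Sum>i<N. s ^ e' i *\<^sub>R g' i x)"
        by (rule sum.cong) (simp_all add: e'_def g'_def)
      also have "(\<Sum>i<N. s ^ Suc (e i) *\<^sub>R dirder y1 (g i) x) = (\<Sum>i=N..<N + N. s ^ e' i *\<^sub>R g' i x)"
        using sum.shift_bounds_nat_ivl[of "\<lambda>i. s ^ e' i *\<^sub>R g' i x" 0 N N]
        by (simp add: e'_def g'_def lessThan_atLeast0)
      also have "(\<Sum>i<N. s ^ e' i *\<^sub>R g' i x) + (\<Sum>i=N..<N + N. s ^ e' i *\<^sub>R g' i x)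
          = (\<Sum>i<N + N. s ^ e' i *\<^sub>R g' i x)"
        unfolding lessThan_atLeast0 by (rule sum.atLeastLessThan_concat) simp_all
      finally show ?thesis .
    qed
    moreover have "smooth_on U (g' i)" for i
      by (simp add: g'_def smooth_on_dirder g)
    ultimately show ?case by blast
  qed
  then show thesis using that by blast
qed

lemma dirder_funpow_polynomial:
  assumes "open U" "smooth_on U f" "x \<in> U"
  obtains p :: "real poly" where "\<And>s. (dirder (y0 + s *\<^sub>R y1) ^^ k) f x \<bullet> \<xi> = poly p s"
proof -
  obtain N :: nat and e g where
    "\<And>s x. x \<in> U \<Longrightarrow> (dirder (y0 + s *\<^sub>R y1) ^^ k) f x = (\<Sum>i<N. s ^ e i *\<^sub>R g i x)"
    using dirder_funpow_expansion[OF assms(1,2)] by metis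
  then have "(dirder (y0 + s *\<^sub>R y1) ^^ k) f x \<bullet> \<xi> = poly (\<Sum>i<N. monom (g i x \<bullet> \<xi>) (e i)) s" for s
    using assms(3) by (simp add: inner_sum_left poly_sum poly_monom mult.commute)
  then show thesis using that by blast
qed

section \<open>Germs that take vector lines to circles\<close>

lemma vector_line_span:
  assumes "vector_line L"
  obtains y where "y \<noteq> 0" "L = span {y}"
proof -
  have L: "subspace L" "dim L = 1"
    using assms by (auto simp: vector_line_def)
  then obtain y where "y \<in> L" "y \<noteq> 0"
    by (metis dim_eq_0 insert_iff subsetI zero_neq_one)
  then show thesis
    using that dim_1_subspace_eq_span[OF L] by blast
qed

lemma vector_line_span_singleton: "y \<noteq> 0 \<Longrightarrow> vector_line (span {y})"
  by (simp add: vector_line_def)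

lemma germ_image_in_spanI:
  assumes "open U" "0 \<in> U" "\<And>t. t *\<^sub>R y \<in> U \<Longrightarrow> f (t *\<^sub>R y) \<in> C"
  shows "germ_image_in f (span {y}) C"
  unfolding germ_image_in_def eventually_nhds
  using assms by (intro exI[of _ U]) (auto simp: span_singleton)

lemma germ_image_in_spanD:
  assumes "germ_image_in f (span {y}) C"
  obtains I where "open I" "(0::real) \<in> I" "\<And>t. t \<in> I \<Longrightarrow> f (t *\<^sub>R y) \<in> C"
proof -
  obtain W where W: "open W" "0 \<in> W" "\<And>z. z \<in> W \<Longrightarrow> z \<in> span {y} \<Longrightarrow> f z \<in> C"
    using assms unfolding germ_image_in_def eventually_nhds by blast
  have "open ((\<lambda>t. t *\<^sub>R y) -` W)"
    by (intro open_vimage W(1) continuous_intros)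
  then show thesis
    using that[of "(\<lambda>t. t *\<^sub>R y) -` W"] W(2,3) by (auto simp: span_singleton)
qed

text \<open>One neighbourhood \<open>U\<close> carries smoothness, the identity on the image of \<open>\<iota>\<close> and the circle
  property of all lines.  That it is common to all lines is used in \<open>\<Phi>_kernel\<close>, where the line varies.\<close>

locale circle_germ =
  fixes \<Phi> :: "'b::euclidean_space \<Rightarrow> 'a::euclidean_space" and \<iota> :: "'a \<Rightarrow> 'b" and U :: "'b set"
  assumes dim: "2 \<le> DIM('a)"
    and U: "open U" "0 \<in> U"
    and linear_\<iota>: "linear \<iota>"
    and smooth: "smooth_on U \<Phi>"
    and \<Phi>_0: "\<Phi> 0 = 0"
    and \<Phi>_\<iota>: "\<And>x. \<iota> x \<in> U \<Longrightarrow> \<Phi> (\<iota> x) = x"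
    and circles: "\<And>L. vector_line L \<Longrightarrow> \<exists>C. broad_circle C \<and> \<Phi> ` (L \<inter> U) \<subseteq> C"
    and nondegenerate: "\<And>L. vector_line L \<Longrightarrow> \<not> L \<subseteq> range \<iota> \<Longrightarrow> \<not> degenerates_to_line \<Phi> L"
begin

definition jet :: "nat \<Rightarrow> 'b \<Rightarrow> 'a" where
  "jet k y = (dirder y ^^ k) \<Phi> 0"

definition A :: "'b \<Rightarrow> 'a" where
  "A y = dirder y \<Phi> 0"

definition B :: "'b \<Rightarrow> 'b \<Rightarrow> 'a" where
  "B v w = dirder v (dirder w \<Phi>) 0"

lemma jet_simps: "jet (Suc 0) y = A y" "jet 2 y = B y y"
  by (simp_all add: jet_def A_def B_def numeral_2_eq_2)

lemma linear_A: "linear A"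
  unfolding A_def[abs_def] by (rule linear_dirder[OF smooth U(2)])

lemma bilinear_B: "bilinear B"
  unfolding B_def[abs_def] by (rule bilinear_second_derivative[OF U(1) smooth U(2)])

lemmas B_simps = bilinear_ladd[OF bilinear_B] bilinear_radd[OF bilinear_B]
  bilinear_lmul[OF bilinear_B] bilinear_rmul[OF bilinear_B]
  bilinear_lneg[OF bilinear_B] bilinear_rneg[OF bilinear_B]

lemma open_line_domain: "open {t. t *\<^sub>R y \<in> U}" "0 \<in> {t. t *\<^sub>R y \<in> U}"
proof -
  have "open ((\<lambda>t. t *\<^sub>R y) -` U)"
    by (intro open_vimage U(1) continuous_intros)
  then show "open {t. t *\<^sub>R y \<in> U}" by (simp add: vimage_def)
qed (use U in simp)

lemma curve_derivative:
  assumes "t \<in> {t. t *\<^sub>R y \<in> U}"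
  shows "((\<lambda>t. (dirder y ^^ k) \<Phi> (t *\<^sub>R y)) has_vector_derivative
    (dirder y ^^ Suc k) \<Phi> (t *\<^sub>R y)) (at t)"
  using has_vector_derivative_along_line[OF smooth_on_dirder_funpow[OF smooth]] assms by simp

lemma derivatives_on_\<iota>:
  shows "A (\<iota> x) = x" and "B (\<iota> x) (\<iota> x) = 0"
proof -
  let ?I = "{t. t *\<^sub>R \<iota> x \<in> U}"
  note I = open_line_domain[of "\<iota> x"]
  have "\<Phi> (t *\<^sub>R \<iota> x) = t *\<^sub>R x" if "t \<in> ?I" for t
    using that \<Phi>_\<iota>[of "t *\<^sub>R x"] by (simp add: linear_scale[OF linear_\<iota>])
  then have 0: "\<Phi> (t *\<^sub>R \<iota> x) - t *\<^sub>R x \<in> {0}" if "t \<in> ?I" for t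
    using that by simp
  have 1: "dirder (\<iota> x) \<Phi> (t *\<^sub>R \<iota> x) - x \<in> {0}" if "t \<in> ?I" for t
  proof (rule velocity_in_subspace[OF I(1) that subspace_single_0 0])
    have "((\<lambda>t. t *\<^sub>R x) has_vector_derivative x) (at t)"
      by (auto intro!: derivative_eq_intros)
    then show "((\<lambda>t. \<Phi> (t *\<^sub>R \<iota> x) - t *\<^sub>R x) has_vector_derivative dirder (\<iota> x) \<Phi> (t *\<^sub>R \<iota> x) - x) (at t)"
      using curve_derivative[OF that, of 0] by (intro has_vector_derivative_diff) simp_all
  qed
  from 1[OF I(2)] show "A (\<iota> x) = x" by (simp add: A_def)
  have "dirder (\<iota> x) (dirder (\<iota> x) \<Phi>) (0 *\<^sub>R \<iota> x) - 0 \<in> {0}"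
  proof (rule velocity_in_subspace[OF I subspace_single_0 1])
    show "((\<lambda>t. dirder (\<iota> x) \<Phi> (t *\<^sub>R \<iota> x) - x) has_vector_derivative
        dirder (\<iota> x) (dirder (\<iota> x) \<Phi>) (0 *\<^sub>R \<iota> x) - 0) (at 0)"
      using curve_derivative[OF I(2), of 1]
      by (intro has_vector_derivative_diff has_vector_derivative_const) simp_all
  qed
  then show "B (\<iota> x) (\<iota> x) = 0" by (simp add: B_def)
qed

lemma circle_of_line:
  assumes "A y \<noteq> 0"
  obtains C where "broad_circle C" "\<And>t. t *\<^sub>R y \<in> U \<Longrightarrow> \<Phi> (t *\<^sub>R y) \<in> C"
proof -
  have "y \<noteq> 0" using assms linear_0[OF linear_A] by auto
  then obtain C where "broad_circle C" "\<Phi> ` (span {y} \<inter> U) \<subseteq> C"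
    using circles[OF vector_line_span_singleton] by blast
  then have "\<Phi> (t *\<^sub>R y) \<in> C" if "t *\<^sub>R y \<in> U" for t
    using that span_scale[OF span_base[of y "{y}"], of t] by blast
  then show thesis
    by (rule that[OF \<open>broad_circle C\<close>])
qed

lemma second_order_relation:
  assumes y: "A y \<noteq> 0" and t: "t *\<^sub>R y \<in> U" and \<xi>: "A y \<bullet> \<xi> = 0"
  shows "2 * (A y \<bullet> A y) * (\<Phi> (t *\<^sub>R y) \<bullet> \<xi>) = (\<Phi> (t *\<^sub>R y) \<bullet> \<Phi> (t *\<^sub>R y)) * (B y y \<bullet> \<xi>)"
proof -
  obtain C where C: "broad_circle C" "\<And>t. t *\<^sub>R y \<in> U \<Longrightarrow> \<Phi> (t *\<^sub>R y) \<in> C"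
    by (rule circle_of_line[OF y]) blast
  note I = open_line_domain[of y]
  have d: "((\<lambda>t. \<Phi> (t *\<^sub>R y)) has_vector_derivative dirder y \<Phi> (t *\<^sub>R y)) (at t)"
    "((\<lambda>t. dirder y \<Phi> (t *\<^sub>R y)) has_vector_derivative dirder y (dirder y \<Phi>) (t *\<^sub>R y)) (at t)"
    if "t \<in> {t. t *\<^sub>R y \<in> U}" for t
    using curve_derivative[OF that, of 0] curve_derivative[OF that, of 1] by simp_all
  show ?thesis
    using circle_second_order_relation[OF I d C(1) _ _ _ C(2)[OF t], of \<xi>] C(2) y \<xi> \<Phi>_0
    by (simp add: A_def B_def)
qed

lemma jet_relations:
  assumes y: "A y \<noteq> 0" and \<xi>: "A y \<bullet> \<xi> = 0"
  shows "2 * (A y \<bullet> A y) * (jet 3 y \<bullet> \<xi>) = 6 * (A y \<bullet> B y y) * (B y y \<bullet> \<xi>)"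
    and "2 * (A y \<bullet> A y) * (jet 4 y \<bullet> \<xi>)
      = (6 * (B y y \<bullet> B y y) + 8 * (A y \<bullet> jet 3 y)) * (B y y \<bullet> \<xi>)"
proof -
  note I = open_line_domain[of y]
  have d: "((\<lambda>t. \<Phi> (t *\<^sub>R y)) has_vector_derivative (dirder y ^^ 1) \<Phi> (t *\<^sub>R y)) (at t)"
    "((\<lambda>t. (dirder y ^^ 1) \<Phi> (t *\<^sub>R y)) has_vector_derivative (dirder y ^^ 2) \<Phi> (t *\<^sub>R y)) (at t)"
    "((\<lambda>t. (dirder y ^^ 2) \<Phi> (t *\<^sub>R y)) has_vector_derivative (dirder y ^^ 3) \<Phi> (t *\<^sub>R y)) (at t)"
    "((\<lambda>t. (dirder y ^^ 3) \<Phi> (t *\<^sub>R y)) has_vector_derivative (dirder y ^^ 4) \<Phi> (t *\<^sub>R y)) (at t)"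
    if "t \<in> {t. t *\<^sub>R y \<in> U}" for t
    using curve_derivative[OF that, of 0] curve_derivative[OF that, of 1]
      curve_derivative[OF that, of 2] curve_derivative[OF that, of 3]
    by (simp_all add: eval_nat_numeral)
  have rel: "2 * (A y \<bullet> A y) * (\<Phi> (t *\<^sub>R y) \<bullet> \<xi>) = (\<Phi> (t *\<^sub>R y) \<bullet> \<Phi> (t *\<^sub>R y)) * (B y y \<bullet> \<xi>)"
    if "t \<in> {t. t *\<^sub>R y \<in> U}" for t
    using second_order_relation[OF y _ \<xi>] that by simp
  have jets: "(dirder y ^^ 1) \<Phi> (0 *\<^sub>R y) = A y" "(dirder y ^^ 2) \<Phi> (0 *\<^sub>R y) = B y y"
    "(dirder y ^^ 3) \<Phi> (0 *\<^sub>R y) = jet 3 y" "(dirder y ^^ 4) \<Phi> (0 *\<^sub>R y) = jet 4 y"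
    using jet_simps[of y] by (simp_all add: jet_def)
  have "\<Phi> (0 *\<^sub>R y) = 0" by (simp add: \<Phi>_0)
  from higher_order_relations[OF I d this rel, unfolded jets]
  show "2 * (A y \<bullet> A y) * (jet 3 y \<bullet> \<xi>) = 6 * (A y \<bullet> B y y) * (B y y \<bullet> \<xi>)"
    and "2 * (A y \<bullet> A y) * (jet 4 y \<bullet> \<xi>)
      = (6 * (B y y \<bullet> B y y) + 8 * (A y \<bullet> jet 3 y)) * (B y y \<bullet> \<xi>)"
    by blast+
qed

text \<open>The mixed part of the quadratic map \<open>y \<mapsto> B y y / 2\<close> with respect to \<open>y = a + \<iota> x\<close>: the part of the
  acceleration that is bilinear in \<open>a\<close> and \<open>x\<close>.\<close>

definition acc :: "'b \<Rightarrow> 'a \<Rightarrow> 'a" where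
  "acc a x = (1/2) *\<^sub>R (B a (\<iota> x) + B (\<iota> x) a)"

lemma bilinear_acc: "bilinear acc"
  unfolding bilinear_def
  by (intro conjI allI linearI)
    (simp_all add: acc_def B_simps linear_add[OF linear_\<iota>] linear_scale[OF linear_\<iota>] algebra_simps)

lemmas acc_simps = bilinear_ladd[OF bilinear_acc] bilinear_radd[OF bilinear_acc]
  bilinear_lmul[OF bilinear_acc] bilinear_rmul[OF bilinear_acc] bilinear_lneg[OF bilinear_acc]

lemma A_decomposition: "A a = 0 \<Longrightarrow> A (a + \<iota> x) = x"
  by (simp add: linear_add[OF linear_A] derivatives_on_\<iota>)

lemma B_decomposition: "B (a + \<iota> x) (a + \<iota> x) = B a a + 2 *\<^sub>R acc a x"
  by (simp add: B_simps acc_def derivatives_on_\<iota> algebra_simps)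

text \<open>Put \<open>x = e1 + s e2\<close> and \<open>\<xi> = s e1 - e2\<close>, which is orthogonal to \<open>x\<close>, and let \<open>c0 + s c1\<close> be the
  second derivative along \<open>a + \<iota> x\<close>.  The third order relation says that \<open>1 + s\<^sup>2\<close> divides the product of
  \<open>x \<bullet> (c0 + s c1)\<close> and \<open>(c0 + s c1) \<bullet> \<xi>\<close>.  At \<open>s = i\<close> one has \<open>\<xi> = i x\<close>, so both factors vanish
  together, and the complex number \<open>x \<bullet> (c0 + i c1) = (\<alpha> - \<delta>) + i (\<beta> + \<gamma>)\<close> must be \<open>0\<close>.\<close>

lemma third_order_consequence:
  assumes a: "A a = 0" and e: "norm e1 = 1" "norm e2 = 1" "e1 \<bullet> e2 = 0"
  shows "B a a \<bullet> e1 + 2 * (acc a e1 \<bullet> e1) = 2 * (acc a e2 \<bullet> e2)"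
proof -
  have ee: "e1 \<bullet> e1 = 1" "e2 \<bullet> e2 = 1" "e2 \<bullet> e1 = 0"
    using e by (simp_all add: norm_eq_1 inner_commute)
  define c0 c1 where "c0 = B a a + 2 *\<^sub>R acc a e1" and "c1 = 2 *\<^sub>R acc a e2"
  define y0 y1 where "y0 = a + \<iota> e1" and "y1 = \<iota> e2"
  have y: "y0 + s *\<^sub>R y1 = a + \<iota> (e1 + s *\<^sub>R e2)" for s
    by (simp add: y0_def y1_def linear_add[OF linear_\<iota>] linear_scale[OF linear_\<iota>])
  have Ay: "A (y0 + s *\<^sub>R y1) = e1 + s *\<^sub>R e2" for s
    unfolding y by (rule A_decomposition[OF a])
  have By: "B (y0 + s *\<^sub>R y1) (y0 + s *\<^sub>R y1) = c0 + s *\<^sub>R c1" for s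
    unfolding y B_decomposition by (simp add: c0_def c1_def acc_simps scaleR_add_right)
  obtain p1 p2 where p: "\<And>s. jet 3 (y0 + s *\<^sub>R y1) \<bullet> e1 = poly p1 s" "\<And>s. jet 3 (y0 + s *\<^sub>R y1) \<bullet> e2 = poly p2 s"
    unfolding jet_def using dirder_funpow_polynomial[OF U(1) smooth U(2)] by metis
  define \<alpha> \<beta> \<gamma> \<delta> where "\<alpha> = c0 \<bullet> e1" and "\<beta> = c1 \<bullet> e1" and "\<gamma> = c0 \<bullet> e2" and "\<delta> = c1 \<bullet> e2"
  \<comment> \<open>The factors are congruent to \<open>(\<alpha> - \<delta>) + s (\<beta> + \<gamma>)\<close> and \<open>s (\<alpha> - \<delta>) - (\<beta> + \<gamma>)\<close> modulo \<open>1 + s\<^sup>2\<close>;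
    the subtracted quadratic collects the multiples of \<open>1 + s\<^sup>2\<close> in their product.\<close>
  have main: "- ((\<alpha> - \<delta>) * (\<beta> + \<gamma>)) + ((\<alpha> - \<delta>)\<^sup>2 - (\<beta> + \<gamma>)\<^sup>2) * s + (\<alpha> - \<delta>) * (\<beta> + \<gamma>) * s^2 + 0 * s^3
    = (1 + s^2) * poly (smult (1/3) ([:0, 1:] * p1 - p2)
        - [:- \<delta> * (\<beta> + \<gamma>) + \<beta> * (\<alpha> - \<delta>) + \<beta> * \<delta>, \<delta> * (\<alpha> - \<delta>) + \<beta> * (\<beta> + \<gamma>), \<beta> * \<delta>:]) s" for s
  proof -
    let ?x = "e1 + s *\<^sub>R e2" and ?\<xi> = "s *\<^sub>R e1 - e2"
    have xx: "?x \<bullet> ?x = 1 + s^2"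
      by (simp add: inner_add ee e(3) power2_eq_square)
    have "?x \<noteq> 0"
      using xx by (metis inner_zero_left add_pos_nonneg zero_less_one zero_le_power2 less_irrefl)
    then have nz: "A (y0 + s *\<^sub>R y1) \<noteq> 0"
      unfolding Ay .
    have perp: "A (y0 + s *\<^sub>R y1) \<bullet> ?\<xi> = 0"
      unfolding Ay by (simp add: inner_add inner_diff ee e(3))
    have "2 * (1 + s^2) * (jet 3 (y0 + s *\<^sub>R y1) \<bullet> ?\<xi>)
        = 6 * (?x \<bullet> (c0 + s *\<^sub>R c1)) * ((c0 + s *\<^sub>R c1) \<bullet> ?\<xi>)"
      using jet_relations(1)[OF nz perp] unfolding Ay By xx .
    also have "jet 3 (y0 + s *\<^sub>R y1) \<bullet> ?\<xi> = s * poly p1 s - poly p2 s"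
      by (simp add: inner_diff_right p)
    also have "?x \<bullet> (c0 + s *\<^sub>R c1) = \<alpha> + s * \<beta> + s * \<gamma> + s * s * \<delta>"
      by (simp add: \<alpha>_def \<beta>_def \<gamma>_def \<delta>_def inner_add inner_commute algebra_simps)
    also have "(c0 + s *\<^sub>R c1) \<bullet> ?\<xi> = s * \<alpha> + s * s * \<beta> - \<gamma> - s * \<delta>"
      by (simp add: \<alpha>_def \<beta>_def \<gamma>_def \<delta>_def inner_add inner_diff algebra_simps)
    finally have "(1 + s^2) * ((1/3) * (s * poly p1 s - poly p2 s))
        = (\<alpha> + s * \<beta> + s * \<gamma> + s * s * \<delta>) * (s * \<alpha> + s * s * \<beta> - \<gamma> - s * \<delta>)"
      by (simp add: field_simps)
    moreover have "poly (smult (1/3) ([:0, 1:] * p1 - p2) - [:k0, k1, k2:]) s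
        = (1/3) * (s * poly p1 s - poly p2 s) - (k0 + k1 * s + k2 * s^2)" for k0 k1 k2
      by (simp add: power2_eq_square algebra_simps)
    ultimately show ?thesis
      by (simp only: right_diff_distrib) (simp add: algebra_simps power2_eq_square power3_eq_cube)
  qed
  note coeffs = coefficients_if_one_plus_square_dvd[OF main]
  then have "(\<alpha> - \<delta>) * (\<beta> + \<gamma>) = 0" "(\<alpha> - \<delta>)\<^sup>2 = (\<beta> + \<gamma>)\<^sup>2"
    by simp_all
  then have "\<alpha> = \<delta>"
    by (auto simp: power2_eq_square)
  then show ?thesis
    by (simp add: \<alpha>_def \<delta>_def c0_def c1_def inner_add_left)
qed

lemma orthonormal_pair:
  fixes e1 :: 'a
  assumes "norm e1 = 1"
  obtains e2 where "norm e2 = 1" "e1 \<bullet> e2 = 0"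
proof -
  obtain z where z: "z \<noteq> 0" "orthogonal e1 z"
    using orthogonal_to_vector_exists[OF dim] by blast
  then show thesis
    using that[of "(1 / norm z) *\<^sub>R z"] by (simp add: orthogonal_def)
qed

text \<open>Replacing \<open>a\<close> by \<open>- a\<close> separates the part of \<open>third_order_consequence\<close> that is even in \<open>a\<close> from the
  odd part.\<close>

lemma B_kernel_and_conformality:
  assumes a: "A a = 0" and e: "norm e1 = 1" "norm e2 = 1" "e1 \<bullet> e2 = 0"
  shows "B a a \<bullet> e1 = 0" and "acc a e1 \<bullet> e1 = acc a e2 \<bullet> e2"
proof -
  have "A (- a) = 0"
    using a by (simp add: linear_neg[OF linear_A])
  from third_order_consequence[OF a e] third_order_consequence[OF this e]
  show "B a a \<bullet> e1 = 0" and "acc a e1 \<bullet> e1 = acc a e2 \<bullet> e2"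
    by (simp_all add: B_simps acc_simps)
qed

lemma B_kernel:
  assumes "A a = 0"
  shows "B a a = 0"
proof (rule ccontr)
  assume nz: "B a a \<noteq> 0"
  define e1 where "e1 = (1 / norm (B a a)) *\<^sub>R B a a"
  have e1: "norm e1 = 1" using nz by (simp add: e1_def)
  obtain e2 where "norm e2 = 1" "e1 \<bullet> e2 = 0"
    using orthonormal_pair[OF e1] .
  from B_kernel_and_conformality(1)[OF assms e1 this] nz show False
    by (simp add: e1_def)
qed

definition unit :: 'a where
  "unit = (SOME e. norm e = 1)"

lemma norm_unit: "norm unit = 1"
  unfolding unit_def by (rule someI_ex) (metis norm_Basis nonempty_Basis all_not_in_conv)

definition dil :: "'b \<Rightarrow> real" where
  "dil a = acc a unit \<bullet> unit"

text \<open>The multiple \<open>dil a *\<^sub>R x\<close> of the velocity does not change the circle; what remains of the acceleration is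
  the candidate for the Clifford action of \<open>a\<close>.\<close>

definition S :: "'b \<Rightarrow> 'a \<Rightarrow> 'a" where
  "S a x = acc a x - dil a *\<^sub>R x"

lemma bilinear_S: "bilinear S"
  unfolding bilinear_def
  by (intro conjI allI linearI)
    (simp_all add: S_def dil_def acc_simps inner_add_left algebra_simps)

lemmas S_simps = bilinear_ladd[OF bilinear_S] bilinear_radd[OF bilinear_S]
  bilinear_lmul[OF bilinear_S] bilinear_rmul[OF bilinear_S]

lemma B_eq: "A a = 0 \<Longrightarrow> B (a + \<iota> x) (a + \<iota> x) = 2 *\<^sub>R (dil a *\<^sub>R x + S a x)"
  by (simp add: B_decomposition B_kernel S_def)

lemma S_perp:
  assumes "A a = 0"
  shows "S a x \<bullet> x = 0"
proof -
  have "bilinear (\<lambda>x y. acc a x \<bullet> y)"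
    unfolding bilinear_def
    by (intro conjI allI linearI) (simp_all add: acc_simps inner_add)
  then have "acc a x \<bullet> x = acc a unit \<bullet> unit * (x \<bullet> x)"
    by (rule conformal_form[OF _ _ norm_unit]) (rule B_kernel_and_conformality(2)[OF assms])
  then show ?thesis
    unfolding S_def dil_def inner_diff_left inner_scaleR_left by simp
qed

lemma S_skew:
  assumes "A a = 0"
  shows "S a x \<bullet> y = - (S a y \<bullet> x)"
  using S_perp[OF assms, of "x + y"] S_perp[OF assms, of x] S_perp[OF assms, of y]
  by (simp add: S_simps inner_add)

text \<open>The argument takes place at \<open>x = e1 + s e2\<close>, modulo \<open>1 + s\<^sup>2 = |x|\<^sup>2\<close>.  In the fourth order relation the terms
  \<open>dil a\<^sup>2 |x|\<^sup>2\<close> and \<open>x \<bullet> jet 3 y\<close> are divisible by \<open>1 + s\<^sup>2\<close>, the latter by the third order relation,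
  so \<open>1 + s\<^sup>2\<close> divides \<open>|S a x|\<^sup>2 (S a x \<bullet> \<xi>)\<close> for every \<open>\<xi>\<close> orthogonal to \<open>e1\<close> and \<open>e2\<close>.  If \<open>|S a x|\<^sup>2\<close>
  does not vanish at \<open>s = i\<close>, then \<open>S a\<close> maps the plane of \<open>e1\<close>, \<open>e2\<close> into itself; being skew it is a
  multiple of a rotation there, and then \<open>|S a e1| = |S a e2|\<close> anyway.\<close>

lemma S_conformal_on_pairs:
  assumes a: "A a = 0" and e: "norm e1 = 1" "norm e2 = 1" "e1 \<bullet> e2 = 0"
  shows "S a e1 \<bullet> S a e1 = S a e2 \<bullet> S a e2"
proof (rule ccontr)
  assume neq: "S a e1 \<bullet> S a e1 \<noteq> S a e2 \<bullet> S a e2"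
  have ee: "e1 \<bullet> e1 = 1" "e2 \<bullet> e2 = 1" "e2 \<bullet> e1 = 0"
    using e by (simp_all add: norm_eq_1 inner_commute)
  define S1 S2 where "S1 = S a e1" and "S2 = S a e2"
  define \<sigma> l where "\<sigma> = S1 \<bullet> e2" and "l = dil a"
  have S12: "S1 \<bullet> e1 = 0" "S2 \<bullet> e2 = 0" "S1 \<bullet> e2 = \<sigma>" "S2 \<bullet> e1 = - \<sigma>"
    using S_perp[OF a] S_skew[OF a, of e2 e1] by (simp_all add: S1_def S2_def \<sigma>_def)
  note S12' = S12[unfolded inner_commute[of S1] inner_commute[of S2]]
  define y0 y1 where "y0 = a + \<iota> e1" and "y1 = \<iota> e2"
  have y: "y0 + s *\<^sub>R y1 = a + \<iota> (e1 + s *\<^sub>R e2)" for s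
    by (simp add: y0_def y1_def linear_add[OF linear_\<iota>] linear_scale[OF linear_\<iota>])
  have Ay: "A (y0 + s *\<^sub>R y1) = e1 + s *\<^sub>R e2" for s
    unfolding y by (rule A_decomposition[OF a])
  have By: "B (y0 + s *\<^sub>R y1) (y0 + s *\<^sub>R y1) = 2 *\<^sub>R (l *\<^sub>R (e1 + s *\<^sub>R e2) + (S1 + s *\<^sub>R S2))" for s
    unfolding y B_eq[OF a] by (simp add: S_simps S1_def S2_def l_def)
  have xx: "(e1 + s *\<^sub>R e2) \<bullet> (e1 + s *\<^sub>R e2) = 1 + s^2" for s
    by (simp add: inner_add ee e(3) power2_eq_square)
  have pos: "1 + s^2 \<noteq> 0" for s :: real
    by (metis add_pos_nonneg zero_less_one zero_le_power2 less_irrefl)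
  have Ay0: "A (y0 + s *\<^sub>R y1) \<noteq> 0" for s
    using xx[of s] pos[of s] unfolding Ay by (metis inner_zero_left)
  obtain p1 where p1: "\<And>s. jet 3 (y0 + s *\<^sub>R y1) \<bullet> e1 = poly p1 s"
    unfolding jet_def using dirder_funpow_polynomial[OF U(1) smooth U(2)] by metis
  \<comment> \<open>Testing the third order relation with \<open>\<xi> = s e1 - e2\<close> expresses the \<open>e2\<close>-component of the third
    derivative through its \<open>e1\<close>-component \<open>p1\<close>.\<close>
  have xjet: "(e1 + s *\<^sub>R e2) \<bullet> jet 3 (y0 + s *\<^sub>R y1) = (1 + s^2) * (poly p1 s + 12 * l * \<sigma> * s)" for s
  proof -
    let ?x = "e1 + s *\<^sub>R e2" and ?\<xi> = "s *\<^sub>R e1 - e2" and ?J = "jet 3 (y0 + s *\<^sub>R y1)"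
    have perp: "?x \<bullet> ?\<xi> = 0"
      by (simp add: inner_add inner_diff ee e(3))
    have "2 * (1 + s^2) * (?J \<bullet> ?\<xi>)
        = 6 * (?x \<bullet> (2 *\<^sub>R (l *\<^sub>R ?x + (S1 + s *\<^sub>R S2)))) * ((2 *\<^sub>R (l *\<^sub>R ?x + (S1 + s *\<^sub>R S2))) \<bullet> ?\<xi>)"
      using jet_relations(1)[OF Ay0, of s ?\<xi>] perp by (simp only: Ay By xx)
    also have "?x \<bullet> (2 *\<^sub>R (l *\<^sub>R ?x + (S1 + s *\<^sub>R S2))) = 2 * l * (1 + s^2)"
      by (simp add: inner_add_left inner_add_right inner_scaleR_right ee e(3) S12' algebra_simps power2_eq_square)
    also have "(2 *\<^sub>R (l *\<^sub>R ?x + (S1 + s *\<^sub>R S2))) \<bullet> ?\<xi> = - 2 * \<sigma> * (1 + s^2)"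
      by (simp add: inner_add_left inner_diff_right ee e(3) S12 algebra_simps power2_eq_square)
    finally have "(1 + s^2) * (?J \<bullet> ?\<xi>) = (1 + s^2) * (- 12 * l * \<sigma> * (1 + s^2))"
      by (simp add: algebra_simps)
    then have "?J \<bullet> ?\<xi> = - 12 * l * \<sigma> * (1 + s^2)"
      using pos[of s] by (simp only: mult_left_cancel[OF pos])
    then have J2: "?J \<bullet> e2 = s * poly p1 s + 12 * l * \<sigma> * (1 + s^2)"
      by (simp add: inner_diff_right p1)
    have "?x \<bullet> ?J = ?J \<bullet> e1 + s * (?J \<bullet> e2)"
      by (simp add: inner_add_left inner_commute)
    then show ?thesis
      unfolding J2 p1 by (simp add: algebra_simps power2_eq_square)
  qed
  have perp_zero: "S1 \<bullet> \<xi> = 0 \<and> S2 \<bullet> \<xi> = 0" if \<xi>: "e1 \<bullet> \<xi> = 0" "e2 \<bullet> \<xi> = 0" for \<xi>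
  proof -
    obtain p4 where p4: "\<And>s. jet 4 (y0 + s *\<^sub>R y1) \<bullet> \<xi> = poly p4 s"
      unfolding jet_def using dirder_funpow_polynomial[OF U(1) smooth U(2)] by metis
    define \<alpha> \<beta> \<gamma> u v where "\<alpha> = S1 \<bullet> S1" and "\<beta> = 2 * (S1 \<bullet> S2)" and "\<gamma> = S2 \<bullet> S2"
      and "u = S1 \<bullet> \<xi>" and "v = S2 \<bullet> \<xi>"
    \<comment> \<open>The left side is the product of \<open>|S a x|\<^sup>2 = \<alpha> + \<beta> s + \<gamma> s\<^sup>2\<close> and \<open>S a x \<bullet> \<xi> = u + v s\<close>.\<close>
    have main: "\<alpha> * u + (\<alpha> * v + \<beta> * u) * s + (\<beta> * v + \<gamma> * u) * s^2 + \<gamma> * v * s^3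
      = (1 + s^2) * poly (smult (1/24) p4
          - ([:l * l, 4 * l * \<sigma>:] + smult (1/3) p1) * [:u, v:]) s" for s
    proof -
      let ?x = "e1 + s *\<^sub>R e2" and ?b = "2 *\<^sub>R (l *\<^sub>R (e1 + s *\<^sub>R e2) + (S1 + s *\<^sub>R S2))"
      have perp: "?x \<bullet> \<xi> = 0"
        by (simp add: inner_add \<xi>)
      have arith: "k * ((1/24) * P) = (M + k * ((1/3) * N)) * W"
        if "2 * k * P = (6 * (4 * M) + 8 * (k * N)) * (2 * W)" for k P M N W :: real
      proof -
        have "2 * (k * P) = 48 * (M * W) + 16 * (k * N * W)"
          using that by (simp add: algebra_simps)
        moreover have "k * ((1/24) * P) = (1/24) * (k * P)"
          by simp
        moreover have "(M + k * ((1/3) * N)) * W = M * W + (1/3) * (k * N * W)"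
          by (simp add: algebra_simps)
        ultimately show ?thesis by linarith
      qed
      have "2 * (1 + s^2) * poly p4 s
          = (6 * (?b \<bullet> ?b) + 8 * ((1 + s^2) * (poly p1 s + 12 * l * \<sigma> * s))) * (?b \<bullet> \<xi>)"
        using jet_relations(2)[OF Ay0, of s \<xi>] perp by (simp only: Ay By xx xjet p4)
      also have "?b \<bullet> ?b = 4 * (l * l * (1 + s^2) + (\<alpha> + \<beta> * s + \<gamma> * s^2))"
      proof -
        have "?x \<bullet> (S1 + s *\<^sub>R S2) = 0"
          by (simp add: inner_add S12')
        moreover have "(S1 + s *\<^sub>R S2) \<bullet> (S1 + s *\<^sub>R S2) = \<alpha> + \<beta> * s + \<gamma> * s^2"
          by (simp add: inner_add \<alpha>_def \<beta>_def \<gamma>_def inner_commute[of S2 S1] power2_eq_square algebra_simps)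
        ultimately show ?thesis
          using xx[of s] by (simp add: inner_add_left[of "l *\<^sub>R ?x" "S1 + s *\<^sub>R S2"]
            inner_add_right[of _ "l *\<^sub>R ?x" "S1 + s *\<^sub>R S2"] inner_commute[of "S1 + s *\<^sub>R S2" ?x])
      qed
      also have "?b \<bullet> \<xi> = 2 * (u + v * s)"
        by (simp add: inner_add \<xi> u_def v_def)
      finally have "(1 + s^2) * ((1/24) * poly p4 s)
          = (l * l * (1 + s^2) + (\<alpha> + \<beta> * s + \<gamma> * s^2)
            + (1 + s^2) * ((1/3) * (poly p1 s + 12 * l * \<sigma> * s))) * (u + v * s)"
        by (rule arith)
      moreover have "poly (smult (1/24) p4 - ([:l * l, 4 * l * \<sigma>:] + smult (1/3) p1) * [:u, v:]) s
          = (1/24) * poly p4 s - (l * l + 4 * l * \<sigma> * s + (1/3) * poly p1 s) * (u + v * s)"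
        by (simp add: algebra_simps)
      ultimately show ?thesis
        by (simp only: right_diff_distrib) (simp add: algebra_simps power2_eq_square power3_eq_cube)
    qed
    note coeffs = coefficients_if_one_plus_square_dvd[OF main]
    have 1: "(\<alpha> - \<gamma>) * u = \<beta> * v" and 2: "(\<alpha> - \<gamma>) * v = - \<beta> * u"
      using coeffs by (simp_all add: algebra_simps)
    have nz: "\<alpha> - \<gamma> \<noteq> 0"
      using neq by (simp add: \<alpha>_def \<gamma>_def S1_def S2_def)
    \<comment> \<open>The two equations say that \<open>((\<alpha> - \<gamma>) + i \<beta>) (u + i v) = 0\<close>.\<close>
    have "(\<alpha> - \<gamma>) * ((\<alpha> - \<gamma>) * (u^2 + v^2)) = (\<alpha> - \<gamma>) * (u * ((\<alpha> - \<gamma>) * u) + v * ((\<alpha> - \<gamma>) * v))"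
      by (simp add: algebra_simps power2_eq_square)
    also have "\<dots> = 0"
      unfolding 1 2 by simp
    finally have "u^2 + v^2 = 0"
      using nz by simp
    then have "u = 0 \<and> v = 0"
      by (simp add: sum_power2_eq_zero_iff)
    then show ?thesis
      by (simp add: u_def v_def)
  qed
  have "S1 = \<sigma> *\<^sub>R e2"
  proof -
    let ?\<xi> = "S1 - \<sigma> *\<^sub>R e2"
    have \<xi>: "e1 \<bullet> ?\<xi> = 0" "e2 \<bullet> ?\<xi> = 0"
      by (simp_all add: inner_diff_right S12' ee e(3))
    have "?\<xi> \<bullet> ?\<xi> = S1 \<bullet> ?\<xi> - \<sigma> * (e2 \<bullet> ?\<xi>)"
      unfolding inner_diff_left[of S1] by simp
    also have "\<dots> = 0"
      using perp_zero[OF \<xi>] \<xi> by simp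
    finally show ?thesis by simp
  qed
  moreover have "S2 = - \<sigma> *\<^sub>R e1"
  proof -
    let ?\<xi> = "S2 - (- \<sigma>) *\<^sub>R e1"
    have \<xi>: "e1 \<bullet> ?\<xi> = 0" "e2 \<bullet> ?\<xi> = 0"
      by (simp_all add: inner_diff_right inner_add_right S12' ee e(3))
    have "?\<xi> \<bullet> ?\<xi> = S2 \<bullet> ?\<xi> - (- \<sigma>) * (e1 \<bullet> ?\<xi>)"
      unfolding inner_diff_left[of S2] by simp
    also have "\<dots> = 0"
      using perp_zero[OF \<xi>] \<xi> by simp
    finally show ?thesis by (simp add: eq_neg_iff_add_eq_0)
  qed
  ultimately show False
    using neq by (simp add: S1_def[symmetric] S2_def[symmetric] ee)
qed

definition qf :: "'b \<Rightarrow> 'b \<Rightarrow> real" where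
  "qf a b = S a unit \<bullet> S b unit"

lemma S_conformal:
  assumes "A a = 0"
  shows "S a x \<bullet> S a x = qf a a * (x \<bullet> x)"
proof -
  have "bilinear (\<lambda>x y. S a x \<bullet> S a y)"
    unfolding bilinear_def
    by (intro conjI allI linearI) (simp_all add: S_simps inner_add)
  then have "S a x \<bullet> S a x = S a unit \<bullet> S a unit * (x \<bullet> x)"
    by (rule conformal_form[OF _ _ norm_unit]) (rule S_conformal_on_pairs[OF assms])
  then show ?thesis unfolding qf_def .
qed

text \<open>Polarizing \<open>S_conformal\<close> gives \<open>S a x \<bullet> S a z = qf a a (x \<bullet> z)\<close>; skewness moves one \<open>S a\<close> to the other
  side.\<close>

lemma S_square:
  assumes a: "A a = 0"
  shows "S a (S a x) = - qf a a *\<^sub>R x"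
proof -
  have *: "S a (S a x) \<bullet> z = - qf a a *\<^sub>R x \<bullet> z" for z
  proof -
    have "S a x \<bullet> S a z = qf a a * (x \<bullet> z)"
      using S_conformal[OF a, of "x + z"] S_conformal[OF a, of x] S_conformal[OF a, of z]
      by (simp add: S_simps inner_add inner_commute[of z x] inner_commute[of "S a z" "S a x"] algebra_simps)
    moreover have "S a (S a x) \<bullet> z = - (S a x \<bullet> S a z)"
      unfolding inner_commute[of "S a x" "S a z"] by (rule S_skew[OF a])
    ultimately show ?thesis
      by (simp only: inner_scaleR_left mult_minus_left)
  qed
  show ?thesis by (rule iffD1[OF vector_eq_rdot]) (rule allI, rule *)
qed

lemma \<Phi>_not_germ_constant:
  assumes "A y \<noteq> 0"
  shows "\<not> germ_constant \<Phi> (span {y})"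
proof
  assume "germ_constant \<Phi> (span {y})"
  then obtain p where "germ_image_in \<Phi> (span {y}) {p}"
    unfolding germ_constant_def by blast
  then obtain I where I: "open I" "(0::real) \<in> I" "\<And>t. t \<in> I \<Longrightarrow> \<Phi> (t *\<^sub>R y) \<in> {p}"
    by (rule germ_image_in_spanD) blast
  have "p = 0" using I(3)[OF I(2)] \<Phi>_0 by simp
  have "A y \<in> {0}"
    using velocity_in_subspace[OF I(1,2) subspace_single_0 _ curve_derivative[of 0 y 0]]
      I(3) \<open>p = 0\<close> U(2) by (simp add: A_def)
  with assms show False by simp
qed

lemma not_in_range_\<iota>:
  assumes "A a = 0" "a \<noteq> 0"
  shows "\<not> span {a + \<iota> x} \<subseteq> range \<iota>"
proof
  assume "span {a + \<iota> x} \<subseteq> range \<iota>"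
  then obtain z where z: "a + \<iota> x = \<iota> z"
    using span_base[of "a + \<iota> x" "{a + \<iota> x}"] by blast
  then have "x = z"
    using A_decomposition[OF assms(1), of x] derivatives_on_\<iota>(1)[of z] by simp
  with z assms(2) show False by simp
qed

text \<open>If \<open>S a\<close> kills the unit vector, the second derivative along \<open>y = a + \<iota> unit\<close> is a multiple of the
  velocity, and the second order relation confines the image of the line to a straight line.\<close>

lemma qf_pos:
  assumes a: "A a = 0" "a \<noteq> 0"
  shows "0 < qf a a"
proof (rule ccontr)
  assume "\<not> 0 < qf a a"
  then have "S a unit = 0"
    by (simp add: qf_def)
  define y where "y = a + \<iota> unit"
  have unit: "unit \<bullet> unit = 1" using norm_unit by (simp add: norm_eq_1)
  have Ay: "A y = unit"
    unfolding y_def by (rule A_decomposition[OF a(1)])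
  have By: "B y y = (2 * dil a) *\<^sub>R unit"
    unfolding y_def B_eq[OF a(1)] by (simp add: \<open>S a unit = 0\<close>)
  have "unit \<noteq> 0" using norm_unit by auto
  have "germ_image_in \<Phi> (span {y}) (span {unit})"
  proof (rule germ_image_in_spanI[OF U])
    fix t assume t: "t *\<^sub>R y \<in> U"
    let ?p = "\<Phi> (t *\<^sub>R y)"
    let ?\<xi> = "?p - (?p \<bullet> unit) *\<^sub>R unit"
    have perp: "unit \<bullet> ?\<xi> = 0"
      by (simp add: inner_diff_right unit inner_commute)
    then have "2 * (?p \<bullet> ?\<xi>) = 0"
      using second_order_relation[of y t ?\<xi>] t \<open>unit \<noteq> 0\<close> by (simp only: Ay By unit inner_scaleR_left) simp
    then have "?\<xi> \<bullet> ?\<xi> = 0"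
      using perp unfolding inner_diff_left[of ?p] inner_scaleR_left by simp
    then have "?p = (?p \<bullet> unit) *\<^sub>R unit"
      by simp
    then show "?p \<in> span {unit}"
      by (metis span_singleton rangeI)
  qed
  then have "degenerates_to_line \<Phi> (span {y})"
    unfolding degenerates_to_line_def
    using \<Phi>_not_germ_constant[of y] Ay \<open>unit \<noteq> 0\<close> straight_line_span by auto
  moreover have "y \<noteq> 0"
    using Ay \<open>unit \<noteq> 0\<close> linear_0[OF linear_A] by auto
  ultimately show False
    using nondegenerate[OF vector_line_span_singleton] not_in_range_\<iota>[OF a] y_def by blast
qed

text \<open>For \<open>y = a + \<iota> x\<close> with \<open>x \<noteq> 0\<close>, testing the second order relation with \<open>\<xi> = S a x\<close> gives
  \<open>\<Phi> y \<bullet> S a x = qf a a |\<Phi> y|\<^sup>2\<close>.  Letting \<open>x = s *\<^sub>R unit\<close> tend to \<open>0\<close> yields \<open>qf a a |\<Phi> a|\<^sup>2 = 0\<close>.\<close>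

lemma \<Phi>_kernel:
  assumes a: "A a = 0" "a \<in> U"
  shows "\<Phi> a = 0"
proof (cases "a = 0")
  case True
  then show ?thesis by (simp add: \<Phi>_0)
next
  case False
  have unit: "unit \<bullet> unit = 1" using norm_unit by (simp add: norm_eq_1)
  define p where "p s = \<Phi> (a + s *\<^sub>R \<iota> unit)" for s
  have cont: "isCont \<Phi> a"
    using smooth_on_continuous_on[OF smooth] U(1) a(2) by (simp add: continuous_on_eq_continuous_at)
  have "((\<lambda>s::real. a + s *\<^sub>R \<iota> unit) \<longlongrightarrow> a + 0 *\<^sub>R \<iota> unit) (at 0)"
    by (intro tendsto_intros)
  then have lim: "((\<lambda>s::real. a + s *\<^sub>R \<iota> unit) \<longlongrightarrow> a) (at 0)" by simp
  have p: "(p \<longlongrightarrow> \<Phi> a) (at 0)"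
    unfolding p_def by (rule isCont_tendsto_compose[OF cont lim])
  have "eventually (\<lambda>s::real. a + s *\<^sub>R \<iota> unit \<in> U) (at 0)"
    using topological_tendstoD[OF lim U(1) a(2)] .
  moreover have "eventually (\<lambda>s::real. s \<noteq> 0) (at 0)"
    by (rule eventually_neq_at_within)
  ultimately have ev: "eventually (\<lambda>s. s * (p s \<bullet> S a unit) = qf a a * (p s \<bullet> p s)) (at 0)"
  proof eventually_elim
    case s: (elim s)
    define x where "x = s *\<^sub>R unit"
    have y: "a + \<iota> x = a + s *\<^sub>R \<iota> unit"
      by (simp add: x_def linear_scale[OF linear_\<iota>])
    have xx: "x \<bullet> x = s\<^sup>2" "s\<^sup>2 \<noteq> 0"
      using s(2) by (simp_all add: x_def unit power2_eq_square)
    then have nz: "A (a + \<iota> x) \<noteq> 0"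
      unfolding A_decomposition[OF a(1)] by auto
    have perp: "x \<bullet> S a x = 0"
      using S_perp[OF a(1), of x] by (simp add: inner_commute)
    have "2 * (x \<bullet> x) * (p s \<bullet> S a x) = (p s \<bullet> p s) * ((2 *\<^sub>R (dil a *\<^sub>R x + S a x)) \<bullet> S a x)"
      using second_order_relation[OF nz, of 1 "S a x"] s(1) perp
      unfolding A_decomposition[OF a(1)] B_eq[OF a(1)] by (simp add: y p_def)
    also have "\<dots> = (p s \<bullet> p s) * (2 * (qf a a * (x \<bullet> x)))"
      unfolding inner_scaleR_left inner_add_left perp S_conformal[OF a(1)] by simp
    finally have "s\<^sup>2 * (p s \<bullet> S a x) = s\<^sup>2 * (qf a a * (p s \<bullet> p s))"
      unfolding xx(1) by (simp add: mult.commute)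
    then have "p s \<bullet> S a x = qf a a * (p s \<bullet> p s)"
      using xx(2) by simp
    then show ?case
      by (simp add: x_def S_simps)
  qed
  have "((\<lambda>s. s * (p s \<bullet> S a unit)) \<longlongrightarrow> 0 * (\<Phi> a \<bullet> S a unit)) (at 0)"
    by (intro tendsto_intros p)
  moreover have "((\<lambda>s. qf a a * (p s \<bullet> p s)) \<longlongrightarrow> qf a a * (\<Phi> a \<bullet> \<Phi> a)) (at 0)"
    by (intro tendsto_intros p)
  ultimately have "0 * (\<Phi> a \<bullet> S a unit) = qf a a * (\<Phi> a \<bullet> \<Phi> a)"
    unfolding tendsto_cong[OF ev] by (rule tendsto_unique[OF at_neq_bot])
  then show ?thesis
    using qf_pos[OF a(1) False] by simp
qed

text \<open>The projection to the kernel of \<open>A\<close> along the image of \<open>\<iota>\<close>.\<close>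

definition \<kappa> :: "'b \<Rightarrow> 'b" where
  "\<kappa> y = y - \<iota> (A y)"

lemma A_\<kappa>: "A (\<kappa> y) = 0"
  by (simp add: \<kappa>_def linear_diff[OF linear_A] derivatives_on_\<iota>)

lemma \<kappa>_decomposition: "y = \<kappa> y + \<iota> (A y)"
  by (simp add: \<kappa>_def)

lemma linear_\<kappa>: "linear \<kappa>"
  unfolding \<kappa>_def[abs_def]
  by (intro linear_compose_sub linear_ident linear_compose[OF linear_A linear_\<iota>, unfolded o_def])

text \<open>By \<open>S_square\<close> this is \<open>(1 - S (\<kappa> y))\<^sup>-\<^sup>1 (A y)\<close>.\<close>

definition model :: "'b \<Rightarrow> 'a" where
  "model y = (1 / (1 + qf (\<kappa> y) (\<kappa> y))) *\<^sub>R (A y + S (\<kappa> y) (A y))"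

lemma qf_nonneg: "0 \<le> qf a a"
  by (simp add: qf_def)

lemma model_scale:
  "model (t *\<^sub>R y) = (1 / (1 + t^2 * qf (\<kappa> y) (\<kappa> y))) *\<^sub>R (t *\<^sub>R A y + t^2 *\<^sub>R S (\<kappa> y) (A y))"
  by (simp add: model_def linear_scale[OF linear_A] linear_scale[OF linear_\<kappa>] S_simps qf_def power2_eq_square
      mult.assoc)

lemma model_not_germ_constant:
  assumes "A y \<noteq> 0"
  shows "\<not> germ_constant model (span {y})"
proof
  assume "germ_constant model (span {y})"
  then obtain p where "germ_image_in model (span {y}) {p}"
    unfolding germ_constant_def by blast
  then obtain I where I: "open I" "(0::real) \<in> I" "\<And>t. t \<in> I \<Longrightarrow> model (t *\<^sub>R y) \<in> {p}"
    by (rule germ_image_in_spanD) blast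
  have "p = 0" using I(3)[OF I(2)] model_scale[of 0 y] by simp
  obtain t where t: "t \<in> I" "t \<noteq> 0"
  proof -
    obtain d where "d > 0" "ball 0 d \<subseteq> I"
      using I(1,2) openE by blast
    then have "d / 2 \<in> I" by (auto simp: subset_iff)
    with \<open>d > 0\<close> that[of "d / 2"] show thesis by simp
  qed
  have "1 + t^2 * qf (\<kappa> y) (\<kappa> y) > 0"
    using qf_nonneg[of "\<kappa> y"] by (simp add: add_pos_nonneg)
  moreover have "model (t *\<^sub>R y) = 0"
    using I(3)[OF t(1)] \<open>p = 0\<close> by simp
  ultimately have "t *\<^sub>R A y + t^2 *\<^sub>R S (\<kappa> y) (A y) = 0"
    by (simp add: model_scale)
  then have "(t *\<^sub>R A y + t^2 *\<^sub>R S (\<kappa> y) (A y)) \<bullet> A y = 0"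
    by simp
  then have "t * (A y \<bullet> A y) = 0"
    using S_perp[OF A_\<kappa>, of y "A y"] by (simp add: inner_add_left)
  with t(2) assms show False by simp
qed

text \<open>The second derivative \<open>B y y = 2 *\<^sub>R (dil a *\<^sub>R x + S a x)\<close> lies in the plane of the circle and determines its
  centre \<open>m\<close> through \<open>m \<bullet> x = 0\<close> and \<open>2 (m \<bullet> S a x) = |x|\<^sup>2\<close>; the equation \<open>|p|\<^sup>2 = 2 (m \<bullet> p)\<close> for the
  points of the model then reduces to \<open>|S a x|\<^sup>2 = qf a a |x|\<^sup>2\<close>.\<close>

lemma model_in_circle:
  assumes y: "A y \<noteq> 0" and C: "honest_circle C" "\<And>t. t *\<^sub>R y \<in> U \<Longrightarrow> \<Phi> (t *\<^sub>R y) \<in> C"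
  shows "model (t *\<^sub>R y) \<in> C"
proof -
  define a x where "a = \<kappa> y" and "x = A y"
  have a: "A a = 0" by (simp add: a_def A_\<kappa>)
  have y_eq: "y = a + \<iota> x" by (simp add: a_def x_def \<kappa>_decomposition[symmetric])
  have "0 \<in> C" using C(2)[of 0] U(2) \<Phi>_0 by simp
  obtain P m where P: "subspace P" "dim P = 2" "m \<in> P" "m \<noteq> 0"
      and C_eq: "C = {p \<in> P. p \<bullet> p = 2 * (m \<bullet> p)}"
    by (rule honest_circle_through_0[OF C(1) \<open>0 \<in> C\<close>])
  note I = open_line_domain[of y]
  have d: "((\<lambda>t. \<Phi> (t *\<^sub>R y)) has_vector_derivative dirder y \<Phi> (t *\<^sub>R y)) (at t)"
    "((\<lambda>t. dirder y \<Phi> (t *\<^sub>R y)) has_vector_derivative dirder y (dirder y \<Phi>) (t *\<^sub>R y)) (at t)"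
    if "t \<in> {t. t *\<^sub>R y \<in> U}" for t
    using curve_derivative[OF that, of 0] curve_derivative[OF that, of 1] by simp_all
  have on: "\<Phi> (t *\<^sub>R y) \<in> P \<and> \<Phi> (t *\<^sub>R y) \<bullet> \<Phi> (t *\<^sub>R y) = 2 * (m \<bullet> \<Phi> (t *\<^sub>R y))"
    if "t \<in> {t. t *\<^sub>R y \<in> U}" for t
    using C(2)[of t] that C_eq by auto
  have j: "x \<in> P" "B y y \<in> P" "m \<bullet> x = 0" "m \<bullet> B y y = x \<bullet> x"
    using circle_jet[OF I d P(1) on] \<Phi>_0 by (simp_all add: x_def A_def B_def)
  have By: "B y y = 2 *\<^sub>R (dil a *\<^sub>R x + S a x)"
    unfolding y_eq by (rule B_eq[OF a])
  have "S a x = (1/2) *\<^sub>R B y y - dil a *\<^sub>R x"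
    by (simp add: By)
  then have S_P: "S a x \<in> P"
    using j P(1) by (simp add: subspace_diff subspace_scale)
  have mS: "2 * (m \<bullet> S a x) = x \<bullet> x"
    using j(3,4) by (simp add: By inner_add_right)
  define k where "k = 1 / (1 + t^2 * qf a a)"
  have "1 + t^2 * qf a a > 0"
    using qf_nonneg[of a] by (simp add: add_pos_nonneg)
  then have k: "k * (1 + t^2 * qf a a) = 1"
    by (simp add: k_def)
  have model: "model (t *\<^sub>R y) = k *\<^sub>R (t *\<^sub>R x + t^2 *\<^sub>R S a x)"
    unfolding model_scale by (simp add: k_def a_def x_def)
  have "model (t *\<^sub>R y) \<bullet> model (t *\<^sub>R y) = k * k * (t^2 * (x \<bullet> x) + t^2 * (t^2 * (S a x \<bullet> S a x)))"
    using S_perp[OF a, of x] by (simp add: model inner_add inner_commute power2_eq_square algebra_simps)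
  also have "\<dots> = k * (t^2 * (x \<bullet> x)) * (k * (1 + t^2 * qf a a))"
    by (simp add: S_conformal[OF a] algebra_simps)
  also have "\<dots> = k * (t^2 * (2 * (m \<bullet> S a x)))"
    by (simp add: k mS)
  also have "\<dots> = 2 * (m \<bullet> model (t *\<^sub>R y))"
    by (simp add: model inner_add_right j(3))
  finally have "model (t *\<^sub>R y) \<bullet> model (t *\<^sub>R y) = 2 * (m \<bullet> model (t *\<^sub>R y))" .
  moreover have "model (t *\<^sub>R y) \<in> P"
    unfolding model by (intro subspace_scale subspace_add P(1) j(1) S_P)
  ultimately show ?thesis
    by (simp add: C_eq)
qed

text \<open>Three kinds of lines: those in the kernel of \<open>A\<close>, where both maps vanish; those in the image of \<open>\<iota>\<close>, where
  \<open>S (\<kappa> y) = 0\<close> and both maps follow the tangent; and the others, where nondegeneracy excludes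
  everything but an honest circle.\<close>

lemma same_circle_model:
  assumes "vector_line L"
  shows "same_circle \<Phi> model L"
proof -
  obtain y where y: "y \<noteq> 0" and L: "L = span {y}"
    using vector_line_span[OF assms] .
  show ?thesis
  proof (cases "A y = 0")
    case True
    have "germ_image_in \<Phi> L {0}"
      unfolding L using \<Phi>_kernel True
      by (intro germ_image_in_spanI[OF U]) (simp add: linear_scale[OF linear_A])
    moreover have "germ_image_in model L {0}"
      unfolding L using True bilinear_rzero[OF bilinear_S]
      by (intro germ_image_in_spanI[OF U]) (simp add: model_scale)
    ultimately show ?thesis
      unfolding same_circle_def by blast
  next
    case False
    have "\<exists>C. (honest_circle C \<or> straight_line C) \<and> germ_image_in \<Phi> L C \<and> germ_image_in model L C"
    proof (cases "\<kappa> y = 0")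
      case True
      then have y_eq: "y = \<iota> (A y)"
        using \<kappa>_decomposition[of y] by simp
      have "germ_image_in \<Phi> L (span {A y})"
        unfolding L
      proof (rule germ_image_in_spanI[OF U])
        fix t assume "t *\<^sub>R y \<in> U"
        moreover have "t *\<^sub>R y = \<iota> (t *\<^sub>R A y)"
          using y_eq by (metis linear_scale[OF linear_\<iota>])
        ultimately show "\<Phi> (t *\<^sub>R y) \<in> span {A y}"
          using \<Phi>_\<iota>[of "t *\<^sub>R A y"] by (simp add: span_scale span_base)
      qed
      moreover have "germ_image_in model L (span {A y})"
        unfolding L using True
        by (intro germ_image_in_spanI[OF U])
          (simp add: model_scale bilinear_lzero[OF bilinear_S] span_scale span_base)
      ultimately show ?thesis
        using straight_line_span[OF False] by blast
    next
      case nz: False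
      obtain C where C: "broad_circle C" "\<And>t. t *\<^sub>R y \<in> U \<Longrightarrow> \<Phi> (t *\<^sub>R y) \<in> C"
        by (rule circle_of_line[OF False]) blast
      have im: "germ_image_in \<Phi> L C"
        unfolding L by (rule germ_image_in_spanI[OF U]) (rule C(2))
      have nonconst: "\<not> germ_constant \<Phi> L"
        unfolding L by (rule \<Phi>_not_germ_constant[OF False])
      have "\<not> degenerates_to_line \<Phi> L"
        using nondegenerate[OF assms] not_in_range_\<iota>[OF A_\<kappa> nz, of "A y"] \<kappa>_decomposition[of y] L by simp
      then have "\<not> straight_line C"
        using im nonconst unfolding degenerates_to_line_def by blast
      moreover have "C \<noteq> {p}" for p
        using im nonconst unfolding germ_constant_def by blast
      ultimately have circ: "honest_circle C"
        using C(1) unfolding broad_circle_def by blast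
      have "germ_image_in model L C"
        unfolding L by (rule germ_image_in_spanI[OF U]) (rule model_in_circle[OF False circ C(2)])
      with circ im show ?thesis by blast
    qed
    then show ?thesis
      unfolding same_circle_def L using \<Phi>_not_germ_constant[OF False] model_not_germ_constant[OF False] by blast
  qed
qed

end

section \<open>Representations of Clifford algebras from operators\<close>

definition word_action :: "('v \<Rightarrow> 'a \<Rightarrow> 'a) \<Rightarrow> 'v free_word \<Rightarrow> 'a \<Rightarrow> 'a" where
  "word_action T w = foldr (\<lambda>v f. T v \<circ> f) (letters w) id"

text \<open>The algebra homomorphism from the free algebra that extends \<open>T\<close>.  The sum over
  all words makes it multiplicative on the whole convolution algebra, so that one induction serves every \<open>V\<close>.\<close>

definition alg_action ::
    "('v \<Rightarrow> 'a \<Rightarrow> 'a) \<Rightarrow> 'v free_alg \<Rightarrow> 'a \<Rightarrow> 'a::real_vector" where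
  "alg_action T p x = (\<Sum>w\<in>Poly_Mapping.keys p. Poly_Mapping.lookup p w *\<^sub>R word_action T w x)"

lemma word_action_zero [simp]: "word_action T 0 = id"
  by (simp add: word_action_def zero_free_word_def)

lemma word_action_letter [simp]: "word_action T (Free_Word [v]) = T v"
  by (simp add: word_action_def)

lemma word_action_plus: "word_action T (u + w) = word_action T u \<circ> word_action T w"
proof -
  have "foldr (\<lambda>v f. T v \<circ> f) xs g = foldr (\<lambda>v f. T v \<circ> f) xs id \<circ> g" for xs g
    by (induction xs) (simp_all add: comp_assoc)
  then show ?thesis
    unfolding word_action_def plus_free_word_def by simp
qed

lemma linear_word_action:
  assumes "\<And>v. linear (T v)"
  shows "linear (word_action T w)"
proof -
  have "linear (foldr (\<lambda>v f. T v \<circ> f) xs id)" for xs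
  proof (induction xs)
    case Nil
    show ?case by (simp add: id_def linear_ident)
  next
    case (Cons v xs)
    show ?case using linear_compose[OF Cons.IH assms[of v]] by (simp add: comp_def)
  qed
  then show ?thesis by (simp add: word_action_def)
qed

lemma alg_action_add: "alg_action T (p + q) x = alg_action T p x + alg_action T q x"
  unfolding alg_action_def
  by (rule setsum_keys_plus_distrib) (simp_all add: scaleR_add_left)

lemma alg_action_zero [simp]: "alg_action T 0 x = 0"
  by (simp add: alg_action_def)

lemma alg_action_single [simp]:
  "alg_action T (Poly_Mapping.single w c) x = c *\<^sub>R word_action T w x"
  by (simp add: alg_action_def)

lemma alg_action_uminus: "alg_action T (- p) x = - alg_action T p x"
  using alg_action_add[of T p "- p" x] by (metis add.right_inverse alg_action_zero minus_unique)

lemma alg_action_diff: "alg_action T (p - q) x = alg_action T p x - alg_action T q x"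
  using alg_action_add[of T p "- q" x] by (simp add: alg_action_uminus)

lemma alg_action_scal [simp]: "alg_action T (scal c) x = c *\<^sub>R x"
  by (simp add: scal_def)

lemma alg_action_gen [simp]: "alg_action T (gen v) x = T v x"
  by (simp add: gen_def)

lemma alg_action_one [simp]: "alg_action T 1 x = x"
  using alg_action_scal[of T 1 x] by (simp only: scal_simps scaleR_one)

lemma linear_alg_action:
  assumes "\<And>v. linear (T v)"
  shows "linear (alg_action T p)"
proof -
  have "alg_action T p = (\<lambda>x. \<Sum>w\<in>Poly_Mapping.keys p. Poly_Mapping.lookup p w *\<^sub>R word_action T w x)"
    by (simp add: fun_eq_iff alg_action_def)
  moreover have "linear (\<lambda>x. Poly_Mapping.lookup p w *\<^sub>R word_action T w x)" for w
    by (rule linear_compose_scale_right[OF linear_word_action[OF assms]])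
  ultimately show ?thesis
    by (simp add: linear_compose_sum)
qed

lemma alg_action_mult:
  assumes T: "\<And>v. linear (T v)"
  shows "alg_action T (p * q) x = alg_action T p (alg_action T q x)"
proof (induction p arbitrary: x rule: update_induct)
  case const
  then show ?case by simp
next
  case (update p w c)
  have "alg_action T (Poly_Mapping.single w c * q) x = c *\<^sub>R word_action T w (alg_action T q x)"
  proof (induction q arbitrary: x rule: update_induct)
    case const
    then show ?case
      by (simp add: linear_0[OF linear_word_action[OF T]])
  next
    case (update q u d)
    have "Poly_Mapping.update u d q = Poly_Mapping.single u d + q"
      using update(1) by (intro poly_mapping_eqI)
        (auto simp: lookup_add lookup_single lookup_update when_def in_keys_iff)
    with update(3) show ?case
      by (simp add: alg_action_add distrib_left mult_single word_action_plus scaleR_add_right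
          linear_add[OF linear_word_action[OF T]] linear_scale[OF linear_word_action[OF T]])
  qed
  moreover have "Poly_Mapping.update w c p = Poly_Mapping.single w c + p"
    using update(1) by (intro poly_mapping_eqI)
      (auto simp: lookup_add lookup_single lookup_update when_def in_keys_iff)
  ultimately show ?case
    using update(3) by (simp add: alg_action_add distrib_right)
qed

lemma ring_End_ring: "Ring.ring (End_ring :: ('a::real_vector \<Rightarrow> 'a) ring)"
proof (rule ringI)
  show "abelian_group (End_ring :: ('a \<Rightarrow> 'a) ring)"
  proof (rule abelian_groupI)
    fix f :: "'a \<Rightarrow> 'a"
    assume "f \<in> carrier End_ring"
    then show "\<exists>g\<in>carrier End_ring. g \<oplus>\<^bsub>End_ring\<^esub> f = \<zero>\<^bsub>End_ring\<^esub>"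
      by (intro bexI[of _ "\<lambda>x. - f x"]) (auto simp: End_ring_def linear_compose_neg)
  qed (auto simp: End_ring_def linear_compose_add fun_eq_iff linear_zero ac_simps)
  show "Group.monoid (End_ring :: ('a \<Rightarrow> 'a) ring)"
    by (rule monoidI) (auto simp: End_ring_def comp_assoc intro: linear_compose simp: id_def linear_ident)
qed (auto simp: End_ring_def fun_eq_iff linear_add)

lemma alg_action_ring_hom:
  assumes "\<And>v. linear (T v)"
  shows "ring_hom_ring (free_algebra V) End_ring (alg_action T)"
proof (rule ring_hom_ringI[OF ring_free_algebra ring_End_ring])
  fix p q
  show "alg_action T p \<in> carrier End_ring"
    by (simp add: End_ring_def linear_alg_action[OF assms])
  show "alg_action T (p \<otimes>\<^bsub>free_algebra V\<^esub> q) = alg_action T p \<otimes>\<^bsub>End_ring\<^esub> alg_action T q"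
    by (rule ext) (simp add: End_ring_def alg_action_mult[OF assms])
  show "alg_action T (p \<oplus>\<^bsub>free_algebra V\<^esub> q) = alg_action T p \<oplus>\<^bsub>End_ring\<^esub> alg_action T q"
    by (rule ext) (simp add: End_ring_def alg_action_add)
  show "alg_action T \<one>\<^bsub>free_algebra V\<^esub> = \<one>\<^bsub>End_ring\<^esub>"
    by (rule ext) (simp add: End_ring_def)
qed

text \<open>The Clifford relation for two vectors follows from the one for a single vector by
  polarization; the relators are thus contained in the kernel of the action, which is an ideal.\<close>

lemma alg_action_clifford_ideal:
  fixes T :: "'v::real_vector \<Rightarrow> 'a::real_vector \<Rightarrow> 'a"
  assumes V: "euclidean_vector_space V q"
    and T: "\<And>v. linear (T v)"
    and add: "\<And>v w x. T (v + w) x = T v x + T w x"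
    and scale: "\<And>c v x. T (c *\<^sub>R v) x = c *\<^sub>R T v x"
    and sq: "\<And>v x. v \<in> V \<Longrightarrow> T v (T v x) = - q v v *\<^sub>R x"
    and p: "p \<in> clifford_ideal V q"
  shows "alg_action T p x = 0"
proof -
  note h = alg_action_ring_hom[OF T, where V = V]
  have kernel: "r \<in> a_kernel (free_algebra V) End_ring (alg_action T)
      \<longleftrightarrow> r \<in> carrier (free_algebra V) \<and> alg_action T r = (\<lambda>x. 0)" for r
    unfolding a_kernel_def' by (auto simp: End_ring_def)
  have polar: "T v (T w x) + T w (T v x) = (- 2 * q v w) *\<^sub>R x" if "v \<in> V" "w \<in> V" for v w x
  proof -
    have "v + w \<in> V"
      using V that by (auto simp: euclidean_vector_space_def intro: subspace_add)
    have "\<forall>u\<in>V. \<forall>v\<in>V. \<forall>w\<in>V. q (u + v) w = q u w + q v w"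
      using V unfolding euclidean_vector_space_def by (elim conjE)
    moreover have "\<forall>v\<in>V. \<forall>w\<in>V. q v w = q w v"
      using V unfolding euclidean_vector_space_def by (elim conjE)
    ultimately have q_add: "q (a + b) c = q a c + q b c" and q_sym: "q a b = q b a"
      if "a \<in> V" "b \<in> V" "c \<in> V" for a b c
      using that by auto
    have "q (v + w) (v + w) = q (v + w) v + q (v + w) w"
      using q_add[OF that \<open>v + w \<in> V\<close>] q_sym[OF that(1) \<open>v + w \<in> V\<close> that(1)]
        q_sym[OF that(2) \<open>v + w \<in> V\<close> that(1)] by linarith
    also have "\<dots> = q v v + 2 * q v w + q w w"
      using q_add[OF that that(1)] q_add[OF that that(2)] q_sym[OF that that(1)] by linarith
    finally have "q (v + w) (v + w) = q v v + 2 * q v w + q w w" .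
    moreover have "T (v + w) (T (v + w) x)
        = T v (T v x) + (T v (T w x) + T w (T v x)) + T w (T w x)"
      by (simp add: add linear_add[OF T])
    ultimately show ?thesis
      using sq[OF \<open>v + w \<in> V\<close>, of x] sq[OF that(1), of x] sq[OF that(2), of x]
      by (simp add: algebra_simps)
  qed
  have "clifford_relators V q \<subseteq> a_kernel (free_algebra V) End_ring (alg_action T)"
  proof
    fix r assume r: "r \<in> clifford_relators V q"
    have "alg_action T r = (\<lambda>x. 0)"
    proof (rule ext)
      fix x
      from r consider v w where "r = gen (v + w) - (gen v + gen w)"
        | c v where "r = gen (c *\<^sub>R v) - scal c * gen v"
        | v w where "v \<in> V" "w \<in> V" "r = gen v * gen w + gen w * gen v - scal (- 2 * q v w)"
        unfolding clifford_relators_def by blast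
      then show "alg_action T r x = 0"
      proof cases
        case 1
        then show ?thesis by (simp add: alg_action_diff alg_action_add add)
      next
        case 2
        then show ?thesis by (simp add: alg_action_diff alg_action_mult[OF T] scale)
      next
        case 3
        have "alg_action T r x = T v (T w x) + T w (T v x) - (- 2 * q v w) *\<^sub>R x"
          unfolding 3(3) alg_action_diff alg_action_add alg_action_mult[OF T] alg_action_gen alg_action_scal ..
        then show ?thesis unfolding polar[OF 3(1,2)] by simp
      qed
    qed
    moreover have "r \<in> carrier (free_algebra V)"
      using clifford_relators_carrier[OF V] r by blast
    ultimately show "r \<in> a_kernel (free_algebra V) End_ring (alg_action T)"
      unfolding kernel by blast
  qed
  then have "clifford_ideal V q \<subseteq> a_kernel (free_algebra V) End_ring (alg_action T)"
    unfolding clifford_ideal_def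
    by (rule ring.genideal_minimal[OF ring_free_algebra ring_hom_ring.kernel_is_ideal[OF h]])
  from subsetD[OF this p] show ?thesis
    unfolding kernel by simp
qed

lemma cliff_class_eqD:
  assumes V: "euclidean_vector_space V q"
    and "a \<in> carrier (free_algebra V)" "b \<in> carrier (free_algebra V)"
    and "cliff_class V q a = cliff_class V q b"
  shows "a - b \<in> clifford_ideal V q"
proof -
  have "a \<ominus>\<^bsub>free_algebra V\<^esub> b \<in> clifford_ideal V q"
    using assms(4)
    unfolding ring.quotient_eq_iff_same_a_r_cos[OF ring_free_algebra ideal_clifford_ideal[OF V] assms(2,3)]
      cliff_class_def .
  then show ?thesis
    unfolding free_algebra_minus[OF assms(2,3)] .
qed

text \<open>The universal property of the Clifford algebra: since \<open>alg_action T\<close> vanishes on the Clifford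
  ideal, it may be evaluated on any representative of a class.\<close>

lemma clifford_representation_exists:
  fixes T :: "'v::real_vector \<Rightarrow> 'a::real_vector \<Rightarrow> 'a"
  assumes V: "euclidean_vector_space V q"
    and T: "\<And>v. linear (T v)"
    and add: "\<And>v w x. T (v + w) x = T v x + T w x"
    and scale: "\<And>c v x. T (c *\<^sub>R v) x = c *\<^sub>R T v x"
    and sq: "\<And>v x. v \<in> V \<Longrightarrow> T v (T v x) = - q v v *\<^sub>R x"
  obtains \<phi> where "clifford_representation V q \<phi>"
    and "\<And>p. p \<in> carrier (free_algebra V) \<Longrightarrow> \<phi> (cliff_class V q p) = alg_action T p"
proof
  define \<phi> where "\<phi> X = alg_action T (SOME p. p \<in> carrier (free_algebra V) \<and> X = cliff_class V q p)" for X
  have \<phi>: "\<phi> (cliff_class V q p) = alg_action T p" if p: "p \<in> carrier (free_algebra V)" for p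
  proof -
    let ?p = "SOME p'. p' \<in> carrier (free_algebra V) \<and> cliff_class V q p = cliff_class V q p'"
    have s: "?p \<in> carrier (free_algebra V) \<and> cliff_class V q p = cliff_class V q ?p"
      by (rule someI[of _ p]) (simp add: p)
    then have "p - ?p \<in> clifford_ideal V q"
      by (intro cliff_class_eqD[OF V p]) auto
    from alg_action_clifford_ideal[OF V T add scale sq this]
    show ?thesis by (auto simp: \<phi>_def fun_eq_iff alg_action_diff)
  qed
  show "\<phi> (cliff_class V q p) = alg_action T p" if "p \<in> carrier (free_algebra V)" for p
    by (rule \<phi>[OF that])
  have carr: "\<exists>p\<in>carrier (free_algebra V). X = cliff_class V q p" if "X \<in> carrier (Cliff V q)" for X
    using that by (auto simp: Cliff_def FactRing_def A_RCOSETS_def' cliff_class_def)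
  have cadd: "cliff_class V q a \<oplus>\<^bsub>Cliff V q\<^esub> cliff_class V q b = cliff_class V q (a + b)"
    if "a \<in> carrier (free_algebra V)" "b \<in> carrier (free_algebra V)" for a b
  proof -
    interpret I: ideal "clifford_ideal V q" "free_algebra V" by (rule ideal_clifford_ideal[OF V])
    show ?thesis
      using I.a_rcos_sum[OF that] by (simp add: Cliff_def FactRing_def cliff_class_def)
  qed
  have cone: "\<one>\<^bsub>Cliff V q\<^esub> = cliff_class V q 1"
    by (simp add: Cliff_def FactRing_def cliff_class_def)
  have "\<phi> \<in> ring_hom (Cliff V q) End_ring"
  proof (rule ring_hom_memI)
    fix X assume "X \<in> carrier (Cliff V q)"
    with carr obtain a where a: "a \<in> carrier (free_algebra V)" "X = cliff_class V q a" by blast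
    then show "\<phi> X \<in> carrier End_ring"
      by (simp add: \<phi> End_ring_def linear_alg_action T)
    fix Y assume "Y \<in> carrier (Cliff V q)"
    with carr obtain b where b: "b \<in> carrier (free_algebra V)" "Y = cliff_class V q b" by blast
    show "\<phi> (X \<otimes>\<^bsub>Cliff V q\<^esub> Y) = \<phi> X \<otimes>\<^bsub>End_ring\<^esub> \<phi> Y"
      using a b by (simp add: cliff_class_mult[OF V] \<phi> mult_carrier fun_eq_iff alg_action_mult T End_ring_def)
    show "\<phi> (X \<oplus>\<^bsub>Cliff V q\<^esub> Y) = \<phi> X \<oplus>\<^bsub>End_ring\<^esub> \<phi> Y"
      using a b by (simp add: cadd \<phi> add_carrier fun_eq_iff alg_action_add End_ring_def)
  next
    show "\<phi> \<one>\<^bsub>Cliff V q\<^esub> = \<one>\<^bsub>End_ring\<^esub>"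
      by (simp add: cone \<phi> one_carrier End_ring_def fun_eq_iff)
  qed
  then show "clifford_representation V q \<phi>"
    by (simp add: clifford_representation_def \<phi> scal_carrier fun_eq_iff)
qed

section \<open>Realization by a Clifford map\<close>

lemma lookup_scaleR: "Poly_Mapping.lookup (c *\<^sub>R p) i = c *\<^sub>R Poly_Mapping.lookup p i"
proof -
  have "finite {i. c *\<^sub>R Poly_Mapping.lookup p i \<noteq> 0}"
    by (rule finite_subset[OF _ finite_lookup[of p]]) auto
  then show ?thesis
    by (simp add: scaleR_poly_mapping_def)
qed

text \<open>This is used for its linear structure only; the inner product of the Clifford algebra comes from
  \<open>qf\<close>, not from the embedded space.\<close>

lemma euclidean_embedding:
  obtains h :: "'b::euclidean_space \<Rightarrow> (nat \<Rightarrow>\<^sub>0 real)" and g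
  where "linear h" "linear g" "\<And>y. g (h y) = y"
proof -
  obtain f :: "nat \<Rightarrow> 'b" where f: "bij_betw f {0..<DIM('b)} Basis"
    using ex_bij_betw_nat_finite[OF finite_Basis] by blast
  define h :: "'b \<Rightarrow> (nat \<Rightarrow>\<^sub>0 real)" where
    "h y = (\<Sum>i<DIM('b). Poly_Mapping.single i (y \<bullet> f i))" for y
  define g :: "(nat \<Rightarrow>\<^sub>0 real) \<Rightarrow> 'b" where
    "g p = (\<Sum>i<DIM('b). Poly_Mapping.lookup p i *\<^sub>R f i)" for p
  have single: "Poly_Mapping.single i (c * d) = c *\<^sub>R Poly_Mapping.single i d" for i :: nat and c d :: real
    by (rule poly_mapping_eqI) (simp add: lookup_scaleR lookup_single when_def)
  have "linear h"
    by (rule linearI) (simp_all add: h_def inner_add_left single_add sum.distrib single scaleR_sum_right)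
  moreover have "linear g"
    by (rule linearI) (simp_all add: g_def lookup_add scaleR_add_left sum.distrib lookup_scaleR
        scaleR_sum_right)
  moreover have "g (h y) = y" for y
  proof -
    have "Poly_Mapping.lookup (h y) i = y \<bullet> f i" if "i < DIM('b)" for i
      using that by (simp add: h_def lookup_sum lookup_single when_def)
    then have "g (h y) = (\<Sum>i\<in>{0..<DIM('b)}. (y \<bullet> f i) *\<^sub>R f i)"
      unfolding g_def lessThan_atLeast0 by (intro sum.cong) auto
    also have "\<dots> = (\<Sum>b\<in>Basis. (y \<bullet> b) *\<^sub>R b)"
      by (rule sum.reindex_bij_betw[OF f])
    finally show ?thesis by (simp add: euclidean_representation)
  qed
  ultimately show thesis by (rule that)
qed

context circle_germ
begin

lemma dist_S_plus_scalar:
  assumes "A a = 0"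
  shows "dist (S a x + t *\<^sub>R x) (S a y + t *\<^sub>R y) = sqrt (qf a a + t\<^sup>2) * dist x y"
proof -
  define z where "z = x - y"
  have "(S a x + t *\<^sub>R x) - (S a y + t *\<^sub>R y) = S a z + t *\<^sub>R z"
    by (simp add: z_def bilinear_rsub[OF bilinear_S] scaleR_diff_right)
  moreover have "(S a z + t *\<^sub>R z) \<bullet> (S a z + t *\<^sub>R z) = (qf a a + t\<^sup>2) * (z \<bullet> z)"
  proof -
    have "z \<bullet> S a z = 0"
      using S_perp[OF assms, of z] by (simp add: inner_commute)
    then show ?thesis
      using S_perp[OF assms, of z] S_conformal[OF assms, of z]
      by (simp add: inner_add power2_eq_square algebra_simps)
  qed
  ultimately show ?thesis
    unfolding dist_norm norm_eq_sqrt_inner z_def[symmetric] by (simp add: real_sqrt_mult)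
qed

text \<open>\<open>V\<close> is a copy of the kernel of \<open>A\<close> with the form \<open>qf\<close>, on which \<open>v\<close> acts by \<open>S\<close>, and the embedding
  \<open>j\<close> is the splitting of \<open>y\<close> into its kernel part \<open>\<kappa> y\<close> and \<open>A y\<close>.\<close>

lemma clifford_realization:
  obtains V :: "(nat \<Rightarrow>\<^sub>0 real) set" and q
    and \<phi> :: "(nat \<Rightarrow>\<^sub>0 real) free_alg set \<Rightarrow> 'a \<Rightarrow> 'a"
    and j :: "'b \<Rightarrow> (nat \<Rightarrow>\<^sub>0 real) \<times> 'a"
  where "euclidean_vector_space V q" "clifford_representation V q \<phi>" "metric_compatible V q \<phi>"
    "linear j" "inj j" "range j \<subseteq> V \<times> UNIV" "\<forall>x. j (\<iota> x) = (0, x)"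
    "clifford_map V q \<phi> \<circ> j = model"
proof -
  obtain h :: "'b \<Rightarrow> (nat \<Rightarrow>\<^sub>0 real)" and g where h: "linear h" and g: "linear g"
    and gh: "\<And>y. g (h y) = y"
    by (rule euclidean_embedding) blast
  define K where "K = {a. A a = 0}"
  have K: "subspace K"
    by (simp add: K_def subspace_def linear_0[OF linear_A] linear_add[OF linear_A] linear_scale[OF linear_A])
  define V where "V = h ` K"
  define q where "q v w = qf (g v) (g w)" for v w
  define T where "T v = S (g v)" for v
  have gV: "A (g v) = 0" if "v \<in> V" for v
    using that by (auto simp: V_def K_def gh)
  have V: "euclidean_vector_space V q"
    unfolding euclidean_vector_space_def
  proof (intro conjI ballI allI impI)
    show "subspace V"
      unfolding V_def by (rule linear_subspace_image[OF h K])
    obtain B where "finite B" "span B = K"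
      using basis_subspace_exists[OF K] by blast
    then show "\<exists>B. finite B \<and> V = span B"
      by (intro exI[of _ "h ` B"]) (simp add: V_def linear_span_image[OF h])
  next
    fix u v w
    show "q (u + v) w = q u w + q v w"
      by (simp add: q_def qf_def linear_add[OF g] S_simps inner_add_left)
  next
    fix c v w
    show "q (c *\<^sub>R v) w = c * q v w"
      by (simp add: q_def qf_def linear_scale[OF g] S_simps)
  next
    fix v w
    show "q v w = q w v"
      by (simp add: q_def qf_def inner_commute)
  next
    fix v
    assume v: "v \<in> V" "v \<noteq> 0"
    then have "g v \<noteq> 0"
      using linear_0[OF h] by (auto simp: V_def gh)
    then show "0 < q v v"
      unfolding q_def by (rule qf_pos[OF gV[OF v(1)]])
  qed
  have T: "\<And>v. linear (T v)" "\<And>v w x. T (v + w) x = T v x + T w x"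
    "\<And>c v x. T (c *\<^sub>R v) x = c *\<^sub>R T v x"
    using bilinear_S by (simp_all add: T_def bilinear_def linear_add[OF g] linear_scale[OF g] S_simps)
  have sq: "T v (T v x) = - q v v *\<^sub>R x" if "v \<in> V" for v x
    unfolding T_def q_def by (rule S_square[OF gV[OF that]])
  obtain \<phi> where rep: "clifford_representation V q \<phi>"
    and \<phi>: "\<And>p. p \<in> carrier (free_algebra V) \<Longrightarrow> \<phi> (cliff_class V q p) = alg_action T p"
    by (rule clifford_representation_exists[of V q T, OF V T sq]) blast+
  have compat: "metric_compatible V q \<phi>"
    unfolding metric_compatible_def
  proof (intro ballI allI exI)
    fix v t x y
    assume v: "v \<in> V"
    have "gen v + scal t \<in> carrier (free_algebra V)"
      by (intro add_carrier gen_carrier scal_carrier v)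
    then show "dist (\<phi> (cliff_class V q (gen v + scal t)) x) (\<phi> (cliff_class V q (gen v + scal t)) y)
        = sqrt (q v v + t\<^sup>2) * dist x y"
      using dist_S_plus_scalar[OF gV[OF v]] by (simp add: \<phi> alg_action_add T_def q_def)
  qed
  define j where "j y = (h (\<kappa> y), A y)" for y
  have j: "linear j"
    by (rule linearI) (simp_all add: j_def linear_add[OF h] linear_add[OF linear_\<kappa>] linear_add[OF linear_A]
        linear_scale[OF h] linear_scale[OF linear_\<kappa>] linear_scale[OF linear_A])
  have "inj j"
  proof (rule injI)
    fix y z assume "j y = j z"
    then have "\<kappa> y = \<kappa> z" "A y = A z"
      unfolding j_def by (auto dest: arg_cong[of _ _ g] simp: gh)
    then show "y = z"
      using \<kappa>_decomposition[of y] \<kappa>_decomposition[of z] by simp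
  qed
  have range: "h (\<kappa> y) \<in> V" for y
    by (simp add: V_def K_def A_\<kappa>)
  have "range j \<subseteq> V \<times> UNIV"
    using range by (auto simp: j_def)
  moreover have "\<forall>x. j (\<iota> x) = (0, x)"
    by (simp add: j_def \<kappa>_def derivatives_on_\<iota> linear_0[OF h])
  moreover have "clifford_map V q \<phi> \<circ> j = model"
  proof
    fix y
    let ?M = "\<phi> (cliff_class V q (1 - gen (h (\<kappa> y))))"
    have "1 - gen (h (\<kappa> y)) \<in> carrier (free_algebra V)"
      by (intro diff_carrier one_carrier gen_carrier range)
    then have M: "?M x = x - S (\<kappa> y) x" for x
      by (simp add: \<phi> alg_action_diff T_def gh)
    have "0 < 1 + qf (\<kappa> y) (\<kappa> y)"
      using qf_nonneg[of "\<kappa> y"] by simp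
    moreover have "A y + S (\<kappa> y) (A y) - S (\<kappa> y) (A y + S (\<kappa> y) (A y)) = (1 + qf (\<kappa> y) (\<kappa> y)) *\<^sub>R A y"
      by (simp add: S_simps S_square[OF A_\<kappa>] scaleR_add_left)
    ultimately have "?M (model y) = A y"
      unfolding M model_def bilinear_rmul[OF bilinear_S] scaleR_diff_right[symmetric] by simp
    moreover have "inj ?M"
      using bij_clifford_operator[OF V rep range] by (rule bij_is_inj)
    ultimately show "(clifford_map V q \<phi> \<circ> j) y = model y"
      by (simp add: clifford_map_def j_def inv_f_eq)
  qed
  ultimately show thesis
    by (rule that[OF V rep compat j \<open>inj j\<close>])
qed

end

theorem theorem4p1:
  fixes n r :: nat
    and \<iota> :: "'a::euclidean_space \<Rightarrow> 'b::euclidean_space"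
    and \<Phi> :: "'b \<Rightarrow> 'a"
  assumes "n \<ge> 2" and "DIM('a) = n" and "DIM('b) = r + n"
    and "linear \<iota>" and "inj \<iota>"
    and "smooth_germ \<Phi>" and "\<Phi> 0 = 0"
    and "\<forall>\<^sub>F x in nhds 0. \<Phi> (\<iota> x) = x"
    and "takes_vector_lines_to_circles \<Phi>"
    and "\<forall>L. vector_line L \<and> \<not> L \<subseteq> range \<iota> \<longrightarrow> \<not> degenerates_to_line \<Phi> L"
  shows "\<exists>(V :: (nat \<Rightarrow>\<^sub>0 real) set) q
            (\<phi> :: (nat \<Rightarrow>\<^sub>0 real) free_alg set \<Rightarrow> 'a \<Rightarrow> 'a)
            (j :: 'b \<Rightarrow> (nat \<Rightarrow>\<^sub>0 real) \<times> 'a).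
           euclidean_vector_space V q \<and>
           clifford_representation V q \<phi> \<and> metric_compatible V q \<phi> \<and>
           linear j \<and> inj j \<and> range j \<subseteq> V \<times> UNIV \<and> (\<forall>x. j (\<iota> x) = (0, x)) \<and>
           (\<forall>L. vector_line L \<longrightarrow> same_circle \<Phi> (clifford_map V q \<phi> \<circ> j) L)"
proof -
  obtain U1 where U1: "open U1" "0 \<in> U1" "\<And>k. Ck_on k U1 \<Phi>"
    using assms(6) unfolding smooth_germ_def by blast
  obtain U2 where U2: "open U2" "0 \<in> U2"
    "\<And>L. vector_line L \<Longrightarrow> \<exists>C. broad_circle C \<and> \<Phi> ` (L \<inter> U2) \<subseteq> C"
    using assms(9) unfolding takes_vector_lines_to_circles_def by blast
  obtain W where W: "open W" "0 \<in> W" "\<And>x. x \<in> W \<Longrightarrow> \<Phi> (\<iota> x) = x"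
    using assms(8) unfolding eventually_nhds by blast
  obtain \<epsilon> where \<epsilon>: "0 < \<epsilon>" "ball 0 \<epsilon> \<subseteq> W"
    using W(1,2) openE by blast
  \<comment> \<open>The injection \<open>\<iota>\<close> is bounded below, so that small values \<open>\<iota> x\<close> come from small \<open>x\<close>.\<close>
  obtain B where B: "0 < B" "\<And>x. B * norm x \<le> norm (\<iota> x)"
    using linear_inj_bounded_below_pos[OF assms(4,5)] by blast
  define U where "U = U1 \<inter> U2 \<inter> ball 0 (B * \<epsilon>)"
  interpret circle_germ \<Phi> \<iota> U
  proof (rule circle_germ.intro)
    show "2 \<le> DIM('a)" using assms(1,2) by simp
    show "open U" "0 \<in> U"
      using U1 U2 B(1) \<epsilon>(1) by (auto simp: U_def)
    show "linear \<iota>" "\<Phi> 0 = 0" by fact+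
    show "smooth_on U \<Phi>"
      unfolding smooth_on_def U_def by (intro allI Ck_on_subset[OF U1(3)]) auto
    show "\<Phi> (\<iota> x) = x" if "\<iota> x \<in> U" for x
    proof -
      have "B * norm x < B * \<epsilon>"
        using that B(2)[of x] by (simp add: U_def)
      then have "x \<in> ball 0 \<epsilon>" using B(1) by simp
      then show ?thesis using \<epsilon>(2) W(3) by blast
    qed
    show "\<exists>C. broad_circle C \<and> \<Phi> ` (L \<inter> U) \<subseteq> C" if "vector_line L" for L
    proof -
      have "\<Phi> ` (L \<inter> U) \<subseteq> \<Phi> ` (L \<inter> U2)" by (auto simp: U_def)
      with U2(3)[OF that] show ?thesis by (meson order_trans)
    qed
    show "\<not> degenerates_to_line \<Phi> L" if "vector_line L" "\<not> L \<subseteq> range \<iota>" for L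
      using assms(10) that by blast
  qed
  obtain V :: "(nat \<Rightarrow>\<^sub>0 real) set" and q \<phi> j where "euclidean_vector_space V q" "clifford_representation V q \<phi>"
    "metric_compatible V q \<phi>" "linear j" "inj j" "range j \<subseteq> V \<times> UNIV" "\<forall>x. j (\<iota> x) = (0, x)"
    and eq: "clifford_map V q \<phi> \<circ> j = model"
    by (rule clifford_realization)
  moreover have "\<forall>L. vector_line L \<longrightarrow> same_circle \<Phi> (clifford_map V q \<phi> \<circ> j) L"
    unfolding eq using same_circle_model by blast
  ultimately show ?thesis
    by (intro exI[of _ V] exI[of _ q] exI[of _ \<phi>] exI[of _ j] conjI)
qed
end
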